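(* Let $\rho$ be a probability distribution on $\mathbb{R}^d\times\mathbb{R}$ with $\mathbb{E}\|a\|^2<\infty$ and $\mathbb{E}[b^2]<\infty$ for $(a,b)\sim\rho$, with $H=\mathbb{E}[aa^\top]$ invertible, and let $x_*$ be the unique minimizer of $\mathcal{R}(x)=\frac12\mathbb{E}_\rho(\langle x,a\rangle-b)^2$. Assume there are finite constants $R,\sigma,\tilde\kappa$ with (i) $\mathbb{E}[\|a\|^2\, aa^\top]\preccurlyeq R^2 H$, (ii) $\mathbb{E}[(b-\langle x_*,a\rangle)^2 aa^\top]\preccurlyeq \sigma^2 H$, (iii) $\mathbb{E}[\|a\|^2_{H^{-1}}\, aa^\top]\preccurlyeq \tilde\kappa H$. Run the algorithm AcSGD described in the context with step sizes $\alpha,\beta>0$ satisfying $(\alpha+2\beta)R^2\le 1$ and $\alpha\le \frac{\beta}{2\tilde\kappa}$. Then for every integer $T\ge 1$, the weighted average $\bar x_T=\frac{\sum_{t=0}^T (t+1)x_t}{\sum_{t=0}^T(t+1)}$ satisfies $$\mathbb{E}[\mathcal{R}(\bar x_T)]-\mathcal{R}(x_* )\le \min\left\{\frac{12}{\alpha T^2},\frac{48}{\beta T}\right\}\|x_0-x_*\|^2+\frac{72\,\sigma^2 d}{T}.$$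
   Context: $\preccurlyeq$ is the Loewner order on symmetric matrices, and $\|a\|^2_{H^{-1}}=a^\top H^{-1}a$. Samples $(a_t,b_t)_{t\ge0}$ are drawn i.i.d. from $\rho$. AcSGD: given $x_0\in\mathbb{R}^d$, set $z_0=x_0$ and for $t\ge0$ let $g_t=a_t(\langle a_t,x_t\rangle-b_t)$ (the stochastic gradient at $x_t$ using the sample $(a_t,b_t)$) and $y_{t+1}=x_t-\beta g_t$, $z_{t+1}=z_t-\alpha(t+1)g_t$, $(t+2)x_{t+1}=(t+1)y_{t+1}+z_{t+1}$. Expectation is over the samples. *)

theory Defs
  imports "HOL-Probability.Probability"
begin

type_synonym 'd sample = "(real ^ 'd) \<times> real"

definition risk :: "'d sample measure \<Rightarrow> real ^ 'd \<Rightarrow> real" where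
  "risk rho x = (1/2) * (\<integral>p. (x \<bullet> fst p - snd p)^2 \<partial>rho)"

definition wsecond :: "'d::finite sample measure \<Rightarrow> ('d sample \<Rightarrow> real) \<Rightarrow> real ^ 'd ^ 'd" where
  "wsecond rho w = (\<chi> i j. \<integral>p. w p * (fst p $ i) * (fst p $ j) \<partial>rho)"

definition loewner_le :: "real ^ 'd ^ 'd \<Rightarrow> real ^ 'd ^ 'd \<Rightarrow> bool" where
  "loewner_le A B \<longleftrightarrow> (\<forall>v. v \<bullet> (A *v v) \<le> v \<bullet> (B *v v))"

fun acsgd :: "real \<Rightarrow> real \<Rightarrow> real ^ 'd \<Rightarrow> (nat \<Rightarrow> 'd sample) \<Rightarrow> nat \<Rightarrow> (real ^ 'd) \<times> (real ^ 'd)" where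
  "acsgd \<alpha> \<beta> x0 \<omega> 0 = (x0, x0)"
| "acsgd \<alpha> \<beta> x0 \<omega> (Suc t) =
     (let x = fst (acsgd \<alpha> \<beta> x0 \<omega> t); z = snd (acsgd \<alpha> \<beta> x0 \<omega> t);
          a = fst (\<omega> t); b = snd (\<omega> t);
          g = (a \<bullet> x - b) *\<^sub>R a;
          y' = x - \<beta> *\<^sub>R g;
          z' = z - (\<alpha> * real (t + 1)) *\<^sub>R g
      in ((1 / real (t + 2)) *\<^sub>R (real (t + 1) *\<^sub>R y' + z'), z'))"

definition acsgd_x :: "real \<Rightarrow> real \<Rightarrow> real ^ 'd \<Rightarrow> (nat \<Rightarrow> 'd sample) \<Rightarrow> nat \<Rightarrow> real ^ 'd" where
  "acsgd_x \<alpha> \<beta> x0 \<omega> t = fst (acsgd \<alpha> \<beta> x0 \<omega> t)"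

definition acsgd_avg :: "real \<Rightarrow> real \<Rightarrow> real ^ 'd \<Rightarrow> (nat \<Rightarrow> 'd sample) \<Rightarrow> nat \<Rightarrow> real ^ 'd" where
  "acsgd_avg \<alpha> \<beta> x0 \<omega> T =
     (1 / (\<Sum>t\<le>T. real (t + 1))) *\<^sub>R (\<Sum>t\<le>T. real (t + 1) *\<^sub>R acsgd_x \<alpha> \<beta> x0 \<omega> t)"

end

theory Submission
  imports Defs
begin

text \<open>In the coordinates \<open>p = (t + 1) (x - x*)\<close> and \<open>z - x*\<close> the algorithm is a
  time-homogeneous linear system driven by random gradients. By linearity it is the sum of a bias
  process, without label noise, and a variance process, started at 0.

  Every gradient is replaced by its conditional mean plus a centred fluctuation, and only the
  deterministic recursion has to be understood. The sum of \<open>(p, H p)\<close> over all times after an impulse along a feature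
  vector \<open>a\<close> is at most \<open>S(a) = 2/3 ((\<alpha>/\<beta>) (a, H\<^sup>-\<^sup>1 a) + (\<beta> + \<alpha>/2) (a, a))\<close>, and the step size conditions
  imply that \<open>E[S(a) a a\<^sup>T]\<close> is at most \<open>2/3 H\<close>. For the bias this means that the
  multiplicative noise raises the deterministic sum of \<open>(p, H p)\<close> by at most the factor 3. For the variance
  process, whose mean vanishes, it means that the covariance of the gradient fluctuation at time
  \<open>t\<close> is at most \<open>3 \<sigma>\<^sup>2 (t + 1)\<^sup>2 H\<close>. The response of the running sum of the \<open>p\<close>'s to one
  such fluctuation is bounded uniformly in time, because after a shift it is again a trajectory of
  the deterministic recursion, with nonincreasing energy; summing over the times gives a variance
  of order \<open>\<sigma>\<^sup>2 d T\<^sup>3\<close> for the sum, hence \<open>\<sigma>\<^sup>2 d / T\<close> for the average.\<close>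

section \<open>The deterministic recursion\<close>

text \<open>The deterministic analysis uses no eigenbasis: it works with quadratic forms of a
  symmetric nonnegative \<open>h\<close> with inverse \<open>hi\<close>, where
  \<open>h_upper\<close> says h^2 \<le> L h. It will be applied with h = H and L = R^2.\<close>

locale accelerated_system =
  fixes h hi :: "'v::real_inner \<Rightarrow> 'v" and L \<alpha> \<beta> :: real
  assumes linear_h: "linear h"
    and h_sym: "h x \<bullet> y = x \<bullet> h y"
    and h_nonneg: "0 \<le> x \<bullet> h x"
    and h_hi [simp]: "h (hi x) = x"
    and hi_h [simp]: "hi (h x) = x"
    and h_upper: "h x \<bullet> h x \<le> L * (x \<bullet> h x)"
    and \<alpha>_pos: "0 < \<alpha>" and \<beta>_pos: "0 < \<beta>"
    and step_L: "(\<alpha> + 2 * \<beta>) * L \<le> 1"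
    and step_\<alpha>\<beta>: "2 * \<alpha> \<le> \<beta>"
begin

lemmas h_simps = linear_add[OF linear_h] linear_diff[OF linear_h] linear_scale[OF linear_h]
  linear_0[OF linear_h] linear_neg[OF linear_h]

lemma linear_hi: "linear hi"
proof (rule linearI)
  show "hi (x + y) = hi x + hi y" for x y
    by (metis h_hi hi_h linear_add[OF linear_h])
  show "hi (c *\<^sub>R x) = c *\<^sub>R hi x" for c x
    by (metis h_hi hi_h linear_scale[OF linear_h])
qed

lemmas hi_simps = linear_add[OF linear_hi] linear_diff[OF linear_hi] linear_scale[OF linear_hi]
  linear_0[OF linear_hi] linear_neg[OF linear_hi]

lemma hi_sym: "hi x \<bullet> y = x \<bullet> hi y"
  by (metis h_hi h_sym)

lemma hi_nonneg: "0 \<le> x \<bullet> hi x"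
  by (metis h_hi h_sym h_nonneg)

lemma norm_le_hi: "x \<bullet> x \<le> L * (x \<bullet> hi x)"
  using h_upper[of "hi x"] by (simp add: inner_commute)

section \<open>Inequalities for the quadratic forms of \<open>h\<close> and its inverse\<close>

lemma h_form_young:
  assumes "0 < c"
  shows "(x + y) \<bullet> h (x + y) \<le> (1 + c) * (x \<bullet> h x) + (1 + 1 / c) * (y \<bullet> h y)"
proof -
  define d where "d = sqrt c"
  have d: "d > 0" "d * d = c" using assms by (auto simp: d_def)
  have "0 \<le> (d *\<^sub>R x - (1 / d) *\<^sub>R y) \<bullet> h (d *\<^sub>R x - (1 / d) *\<^sub>R y)"
    by (rule h_nonneg)
  also have "\<dots> = (d * d) * (x \<bullet> h x) + (1 / (d * d)) * (y \<bullet> h y) - 2 * (x \<bullet> h y)"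
    using d(1) h_sym[of x y] by (simp add: h_simps inner_simps inner_commute field_simps)
  finally show ?thesis
    using d h_sym[of x y] by (simp add: h_simps inner_simps inner_commute field_simps)
qed

text \<open>Cauchy-Schwarz for x and h x, followed by \<open>h_upper\<close>, leaves a common factor
  (x, h x) to cancel. If that factor is 0, then h x = 0 and x = 0.\<close>

lemma h_form_le_norm: "x \<bullet> h x \<le> L * (x \<bullet> x)"
proof (cases "x \<bullet> h x = 0")
  case True
  have "h x \<bullet> h x \<le> 0" using h_upper[of x] True by simp
  then have "h x = 0" by (metis inner_ge_zero inner_eq_zero_iff order_antisym)
  then have "x = 0" by (metis hi_h hi_simps(4))
  then show ?thesis by simp
next
  case False
  then have pos: "0 < x \<bullet> h x" using h_nonneg[of x] by simp
  have "(x \<bullet> h x)^2 \<le> (x \<bullet> x) * (h x \<bullet> h x)"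
    by (rule Cauchy_Schwarz_ineq)
  also have "\<dots> \<le> (x \<bullet> x) * (L * (x \<bullet> h x))"
    by (intro mult_left_mono h_upper) auto
  finally have "(x \<bullet> h x) * (x \<bullet> h x) \<le> (L * (x \<bullet> x)) * (x \<bullet> h x)"
    by (simp add: power2_eq_square mult_ac)
  then show ?thesis using pos by simp
qed

text \<open>The form in which \<open>(\<alpha> + 2 * \<beta>) * L \<le> 1\<close> is always used:
  \<open>v\<close> carries one power of \<open>h\<close> more than \<open>u\<close>, and a
  coefficient up to \<open>c * (\<alpha> + 2 * \<beta>)\<close> in front of it is absorbed by
  \<open>c * u\<close>.\<close>

lemma scaled_le:
  assumes "0 \<le> c" "0 \<le> u" "v \<le> L * u" "c * (\<alpha> + 2 * \<beta>) \<ge> d" "0 \<le> d"  "0 \<le> v"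
  shows "d * v \<le> c * u"
proof -
  have "d * v \<le> c * (\<alpha> + 2 * \<beta>) * v"
    using assms by (intro mult_right_mono) auto
  also have "\<dots> \<le> c * (\<alpha> + 2 * \<beta>) * (L * u)"
    using assms \<alpha>_pos \<beta>_pos by (intro mult_left_mono) auto
  also have "\<dots> = c * (((\<alpha> + 2 * \<beta>) * L) * u)"
    by simp
  also have "\<dots> \<le> c * (1 * u)"
    using assms step_L by (intro mult_left_mono mult_right_mono) auto
  finally show ?thesis by simp
qed

text \<open>In the coordinates p = (t + 1)(x - x*) and z - x*, one step with the expected gradient is the
  time-independent linear map mean_step; an error c in the gradient subtracts impulse c.\<close>

definition mean_step :: "'v \<times> 'v \<Rightarrow> 'v \<times> 'v" where
  "mean_step \<theta> = (fst \<theta> + snd \<theta> - (\<alpha> + \<beta>) *\<^sub>R h (fst \<theta>), snd \<theta> - \<alpha> *\<^sub>R h (fst \<theta>))"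

definition impulse :: "'v \<Rightarrow> 'v \<times> 'v" where
  "impulse c = ((\<alpha> + \<beta>) *\<^sub>R c, \<alpha> *\<^sub>R c)"

text \<open>The Lyapunov function of accelerated gradient descent: at time t the difference p - z is
  t (y_t - xs), so the second term is 2 \<alpha> t^2 times the excess risk of y_t.\<close>

definition energy :: "'v \<times> 'v \<Rightarrow> real" where
  "energy \<theta> = snd \<theta> \<bullet> snd \<theta> + \<alpha> * ((fst \<theta> - snd \<theta>) \<bullet> h (fst \<theta> - snd \<theta>))"

text \<open>Along an eigenvector of h, a noise of variance h in every gradient has a stationary
  covariance, which is a rational function of h; the potential is that covariance with its
  denominator bounded below by 3/2, read as a quadratic form in (p, z).\<close>

definition potential :: "'v \<times> 'v \<Rightarrow> real" where
  "potential \<theta> = 2 / (3 * \<beta>) * (snd \<theta> \<bullet> hi (snd \<theta>) / \<alpha> - \<beta> / (2 * \<alpha>) * (snd \<theta> \<bullet> snd \<theta>)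
     - snd \<theta> \<bullet> fst \<theta> + fst \<theta> \<bullet> fst \<theta>)"

section \<open>Decrease of the energy and of the potential\<close>

lemma energy_mean_step: "energy (mean_step \<theta>) \<le> energy \<theta>"
proof -
  obtain p z where \<theta>: "\<theta> = (p, z)" by (cases \<theta>)
  \<comment> \<open>The mixed terms in p and z cancel. Since \<beta> h \<le> 1/2, the cubic term
    costs at most half of \<beta> (h p, h p), and \<alpha> - 3/2 \<beta> is negative because 2
    \<alpha> \<le> \<beta>.\<close>
  have e: "energy (mean_step \<theta>) - energy \<theta> =
     \<alpha> * ((\<alpha> - 2 * \<beta>) * (h p \<bullet> h p) + \<beta>^2 * (h p \<bullet> h (h p))) - \<alpha> * (z \<bullet> h z)"
    using h_sym[of p z] h_sym[of p "h p"] unfolding energy_def mean_step_def \<theta>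
    by (simp add: h_simps inner_simps inner_commute algebra_simps power2_eq_square)
  have "\<beta> * (h p \<bullet> h (h p)) \<le> (1/2) * (h p \<bullet> h p)"
    by (rule scaled_le) (use h_form_le_norm h_nonneg \<alpha>_pos \<beta>_pos in auto)
  then have "\<beta> * (\<beta> * (h p \<bullet> h (h p))) \<le> \<beta> * ((1/2) * (h p \<bullet> h p))"
    using \<beta>_pos by (intro mult_left_mono) auto
  moreover have "(\<alpha> - 2 * \<beta> + \<beta> / 2) * (h p \<bullet> h p) \<le> 0"
    using step_\<alpha>\<beta> \<beta>_pos by (intro mult_nonpos_nonneg) auto
  ultimately have "(\<alpha> - 2 * \<beta>) * (h p \<bullet> h p) + \<beta>^2 * (h p \<bullet> h (h p)) \<le> 0"
    by (simp add: power2_eq_square algebra_simps)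
  then have "\<alpha> * ((\<alpha> - 2 * \<beta>) * (h p \<bullet> h p) + \<beta>^2 * (h p \<bullet> h (h p))) \<le> 0"
    using \<alpha>_pos by (intro mult_nonneg_nonpos) auto
  moreover have "0 \<le> \<alpha> * (z \<bullet> h z)"
    using \<alpha>_pos h_nonneg by simp
  ultimately show ?thesis using e by linarith
qed

lemma h_form_le_energy: "\<alpha> * (fst \<theta> \<bullet> h (fst \<theta>)) \<le> 6/5 * energy \<theta>"
proof -
  obtain p z where \<theta>: "\<theta> = (p, z)" by (cases \<theta>)
  \<comment> \<open>The weight 1/5 makes both terms fit with the same factor 6/5: 2 \<alpha> \<le>
    \<beta> gives 5 \<alpha> \<le> \<alpha> + 2 \<beta>, so 6 \<alpha> (z, h z) is at most 6/5 (z,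
    z).\<close>
  have "p \<bullet> h p \<le> 6/5 * ((p - z) \<bullet> h (p - z)) + 6 * (z \<bullet> h z)"
    using h_form_young[of "1/5" "p - z" z] by simp
  then have "\<alpha> * (p \<bullet> h p) \<le> \<alpha> * (6/5 * ((p - z) \<bullet> h (p - z)) + 6 * (z \<bullet> h z))"
    using \<alpha>_pos by (intro mult_left_mono) auto
  moreover have "5 * \<alpha> * (z \<bullet> h z) \<le> 1 * (z \<bullet> z)"
    by (rule scaled_le) (use h_form_le_norm h_nonneg \<alpha>_pos \<beta>_pos step_\<alpha>\<beta> in auto)
  ultimately show ?thesis by (simp add: energy_def \<theta> algebra_simps)
qed

lemma potential_mean_step: "potential (mean_step \<theta>) + fst \<theta> \<bullet> h (fst \<theta>) \<le> potential \<theta>"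
proof -
  obtain p z where \<theta>: "\<theta> = (p, z)" by (cases \<theta>)
  let ?Q = "\<lambda>\<theta>. snd \<theta> \<bullet> hi (snd \<theta>) / \<alpha> - \<beta> / (2 * \<alpha>) * (snd \<theta> \<bullet> snd \<theta>)
     - snd \<theta> \<bullet> fst \<theta> + fst \<theta> \<bullet> fst \<theta>"
  have hz: "h p \<bullet> hi z = p \<bullet> z" using h_sym[of p "hi z"] by simp
  \<comment> \<open>Again no mixed terms remain. The second order term eats at most \<beta>/2 of the
    gain 2 \<beta> (p, h p); the prefactor 2/(3 \<beta>) of the potential normalises the remaining 3
    \<beta>/2 to 1.\<close>
  have "?Q (mean_step \<theta>) - ?Q \<theta> =
     - 2 * \<beta> * (p \<bullet> h p) + \<beta> * (\<alpha> / 2 + \<beta>) * (h p \<bullet> h p)"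
    using hz h_sym[of p z] \<alpha>_pos unfolding mean_step_def \<theta>
    by (simp add: hi_simps inner_simps inner_commute field_simps power2_eq_square)
  moreover have "(\<alpha> / 2 + \<beta>) * (h p \<bullet> h p) \<le> (1/2) * (p \<bullet> h p)"
    by (rule scaled_le) (use h_upper h_nonneg \<alpha>_pos \<beta>_pos in auto)
  then have "\<beta> * ((\<alpha> / 2 + \<beta>) * (h p \<bullet> h p)) \<le> \<beta> * ((1/2) * (p \<bullet> h p))"
    using \<beta>_pos by (intro mult_left_mono) auto
  ultimately have "?Q (mean_step \<theta>) + 3 * \<beta> / 2 * (p \<bullet> h p) \<le> ?Q \<theta>"
    by (simp add: algebra_simps)
  then have "2 / (3 * \<beta>) * (?Q (mean_step \<theta>) + 3 * \<beta> / 2 * (p \<bullet> h p)) \<le> 2 / (3 * \<beta>) * ?Q \<theta>"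
    using \<beta>_pos by (intro mult_left_mono) auto
  then show ?thesis
    using \<beta>_pos unfolding potential_def by (simp add: \<theta> distrib_left)
qed

text \<open>Completing the square in p leaves a form in z alone, where \<open>norm_le_hi\<close> and
  the step size bound let the \<open>hi\<close> term dominate the norms.\<close>

lemma potential_nonneg: "0 \<le> potential \<theta>"
proof -
  obtain p z where \<theta>: "\<theta> = (p, z)" by (cases \<theta>)
  let ?v = "p - (1/2) *\<^sub>R z"
  have "(\<beta> / 2 + \<alpha> / 4) * (z \<bullet> z) \<le> 1 * (z \<bullet> hi z)"
    by (rule scaled_le) (use norm_le_hi hi_nonneg \<alpha>_pos \<beta>_pos in auto)
  then have "0 \<le> (z \<bullet> hi z - (\<beta> / 2 + \<alpha> / 4) * (z \<bullet> z)) / \<alpha>"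
    using \<alpha>_pos by simp
  also have "\<dots> \<le> (z \<bullet> hi z - (\<beta> / 2 + \<alpha> / 4) * (z \<bullet> z)) / \<alpha> + ?v \<bullet> ?v"
    by simp
  also have "\<dots> = z \<bullet> hi z / \<alpha> - \<beta> / (2 * \<alpha>) * (z \<bullet> z) - z \<bullet> p + p \<bullet> p"
    using \<alpha>_pos by (simp add: inner_simps inner_commute field_simps)
  finally show ?thesis
    using \<beta>_pos by (simp add: potential_def \<theta>)
qed

text \<open>This is S of the overview. Averaged over the features, its \<open>hi\<close> term is
  controlled by the condition on \<open>\<kappa>\<close> and its norm term by the condition on
  \<open>R\<close>.\<close>

lemma potential_impulse:
  "potential (impulse c) = 2/3 * (\<alpha> / \<beta> * (c \<bullet> hi c) + (\<beta> + \<alpha> / 2) * (c \<bullet> c))"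
  using \<alpha>_pos \<beta>_pos
  by (simp add: potential_def impulse_def hi_simps inner_simps field_simps power2_eq_square)

section \<open>Accumulated cost of the deterministic recursion\<close>

definition cost :: "nat \<Rightarrow> 'v \<times> 'v \<Rightarrow> real" where
  "cost n \<theta> = (\<Sum>k<n. fst ((mean_step ^^ k) \<theta>) \<bullet> h (fst ((mean_step ^^ k) \<theta>)))"

lemma cost_0 [simp]: "cost 0 \<theta> = 0"
  by (simp add: cost_def)

lemma cost_Suc: "cost (Suc n) \<theta> = fst \<theta> \<bullet> h (fst \<theta>) + cost n (mean_step \<theta>)"
  unfolding cost_def
  by (subst sum.lessThan_Suc_shift) (simp add: funpow_Suc_right del: funpow.simps)

lemma cost_nonneg: "0 \<le> cost n \<theta>"
  by (simp add: cost_def sum_nonneg h_nonneg)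

lemma cost_le_potential: "cost n \<theta> \<le> potential \<theta>"
proof (induction n arbitrary: \<theta>)
  case 0
  then show ?case by (simp add: potential_nonneg)
next
  case (Suc n)
  show ?case
    using Suc[of "mean_step \<theta>"] potential_mean_step[of \<theta>] by (simp add: cost_Suc)
qed

text \<open>For the initial state (x, x) the potential contains (x, hi x), which the norm of x does
  not control. The nonincreasing energy gives a bound by the norm instead, at the price of growth
  linear in n; it leads to the 1/(\<alpha> T^2) term.\<close>

lemma cost_le_energy: "\<alpha> * cost n \<theta> \<le> real n * (6/5 * energy \<theta>)"
proof (induction n arbitrary: \<theta>)
  case (Suc n)
  have "\<alpha> * cost (Suc n) \<theta> \<le> 6/5 * energy \<theta> + real n * (6/5 * energy (mean_step \<theta>))"
    using Suc[of "mean_step \<theta>"] h_form_le_energy[of \<theta>] by (simp add: cost_Suc algebra_simps)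
  also have "\<dots> \<le> 6/5 * energy \<theta> + real n * (6/5 * energy \<theta>)"
    by (intro add_left_mono mult_left_mono energy_mean_step) auto
  finally show ?case by (simp add: algebra_simps)
qed simp

lemma norm_snd_le_energy: "(norm (snd \<theta>))\<^sup>2 \<le> energy \<theta>"
  using h_nonneg \<alpha>_pos by (simp add: energy_def power2_norm_eq_inner)

lemma energy_start: "energy (x, x) = (norm x)\<^sup>2"
  by (simp add: energy_def h_simps power2_norm_eq_inner)

text \<open>This bound leads to the 1/(\<beta> T) term. The difference p - z starts at 0 and its
  successor is p - \<beta> h p; this contraction loses at least 3/2 \<beta> (p, h p) in squared
  norm. Adding z, which never exceeds the norm of x, lets the difference grow only linearly.\<close>

lemma cost_start_damped:
  "3/2 * \<beta> * cost n (x, x) \<le> (real n * norm x)\<^sup>2"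
proof -
  have en: "energy ((mean_step ^^ n) (x, x)) \<le> (norm x)\<^sup>2" for n
  proof (induction n)
    case (Suc n)
    then show ?case using energy_mean_step[of "(mean_step ^^ n) (x, x)"] by simp
  qed (simp add: energy_start)
  have z: "norm (snd ((mean_step ^^ n) (x, x))) \<le> norm x" for n
  proof (rule power2_le_imp_le)
    show "(norm (snd ((mean_step ^^ n) (x, x))))\<^sup>2 \<le> (norm x)\<^sup>2"
      using norm_snd_le_energy en by (rule order_trans)
  qed simp
  have "3/2 * \<beta> * cost n (x, x) + (norm (fst ((mean_step ^^ n) (x, x)) - snd ((mean_step ^^ n) (x, x))))\<^sup>2
      \<le> (real n * norm x)\<^sup>2"
  proof (induction n)
    case (Suc n)
    define p z' where "p = fst ((mean_step ^^ n) (x, x))" and "z' = snd ((mean_step ^^ n) (x, x))"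
    have nonneg: "0 \<le> 3/2 * \<beta> * cost n (x, x)"
      using cost_nonneg[of n "(x, x)"] \<beta>_pos by simp
    have cost: "cost (Suc n) (x, x) = cost n (x, x) + p \<bullet> h p"
      by (simp add: cost_def p_def)
    have q: "fst ((mean_step ^^ Suc n) (x, x)) - snd ((mean_step ^^ Suc n) (x, x)) = p - \<beta> *\<^sub>R h p"
      by (simp add: mean_step_def p_def[symmetric] z'_def[symmetric] algebra_simps)
    have "2 * \<beta> * (h p \<bullet> h p) \<le> 1 * (p \<bullet> h p)"
      by (rule scaled_le) (use h_upper h_nonneg \<alpha>_pos \<beta>_pos in auto)
    then have "\<beta> * (2 * \<beta> * (h p \<bullet> h p)) \<le> \<beta> * (1 * (p \<bullet> h p))"
      using \<beta>_pos by (intro mult_left_mono) auto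
    then have p: "(norm (p - \<beta> *\<^sub>R h p))\<^sup>2 + 3/2 * \<beta> * (p \<bullet> h p) \<le> (norm p)\<^sup>2"
      by (simp add: power2_norm_eq_inner inner_simps inner_commute algebra_simps)
    have "(norm (p - z'))\<^sup>2 \<le> (real n * norm x)\<^sup>2"
      using Suc nonneg unfolding p_def[symmetric] z'_def[symmetric] by linarith
    then have qn: "norm (p - z') \<le> real n * norm x"
      by (rule power2_le_imp_le) simp
    have zn: "norm z' \<le> norm x"
      unfolding z'_def by (rule z)
    have "(norm p)\<^sup>2 \<le> (norm (p - z') + norm z')\<^sup>2"
      by (intro power_mono) (use norm_triangle_ineq[of "p - z'" z'] in auto)
    also have "\<dots> = (norm (p - z'))\<^sup>2 + 2 * (norm (p - z') * norm z') + (norm z')\<^sup>2"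
      by (simp add: power2_eq_square algebra_simps)
    \<comment> \<open>Only the mixed and the last term are estimated. The square of the norm of p -
      z' is kept, because the induction hypothesis bounds it together with the cost so far.\<close>
    also have "\<dots> \<le> (norm (p - z'))\<^sup>2 + 2 * (real n * norm x * norm x) + (norm x)\<^sup>2"
      by (intro add_mono mult_left_mono mult_mono qn zn power_mono) auto
    finally have "(norm p)\<^sup>2 \<le> \<dots>" .
    then show ?case
      unfolding cost q using p Suc[folded p_def z'_def]
      by (simp add: power2_eq_square algebra_simps)
  qed simp
  then show ?thesis
    using zero_le_power2[of "norm (fst ((mean_step ^^ n) (x, x)) - snd ((mean_step ^^ n) (x, x)))"]
    by linarith
qed

section \<open>Linearity, responses to impulses, and linear readings of the state\<close>

lemma mean_step_add: "mean_step (x + y) = mean_step x + mean_step y"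
  by (simp add: mean_step_def h_simps scaleR_add_right)

lemma mean_step_scaleR: "mean_step (c *\<^sub>R x) = c *\<^sub>R mean_step x"
  by (simp add: mean_step_def h_simps scaleR_add_right scaleR_diff_right)

lemma linear_mean_step: "linear mean_step"
  by (intro linearI mean_step_add mean_step_scaleR)

lemma linear_funpow_mean_step: "linear (mean_step ^^ n)"
  by (induction n) (auto simp: linear_iff mean_step_add mean_step_scaleR)

lemma linear_impulse: "linear impulse"
  by (intro linearI) (simp_all add: impulse_def scaleR_add_right)

lemma linear_impulse_response: "linear (\<lambda>a. fst ((mean_step ^^ n) (impulse a)))"
  using linear_compose[OF linear_compose[OF linear_impulse linear_funpow_mean_step] linear_fst]
  by (simp add: comp_def)

text \<open>\<open>(hi c, 0)\<close> is the fixed point of the recursion with the constant impulse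
  \<open>c\<close>; measured from it, the recursion is unforced.\<close>

lemma mean_step_impulse_shift:
  "mean_step (fst q - hi c, snd q) = (fst (mean_step q + impulse c) - hi c, snd (mean_step q + impulse c))"
  by (simp add: mean_step_def impulse_def h_simps algebra_simps)

definition grad_step :: "'v \<Rightarrow> 'v \<times> 'v \<Rightarrow> 'v \<times> 'v" where
  "grad_step g \<theta> = (fst \<theta> + snd \<theta> - (\<alpha> + \<beta>) *\<^sub>R g, snd \<theta> - \<alpha> *\<^sub>R g)"

text \<open>Identifies linear functionals of the state with states: as reading_grad_step shows, the
  adjoint of mean_step is then mean_step itself.\<close>

definition reading :: "'v \<times> 'v \<Rightarrow> 'v \<times> 'v \<Rightarrow> real" where
  "reading q \<theta> = fst q \<bullet> snd \<theta> / \<alpha>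
     - snd q \<bullet> ((\<alpha> + \<beta>) *\<^sub>R snd \<theta> - \<alpha> *\<^sub>R fst \<theta>) / \<alpha>\<^sup>2"

lemma reading_impulse: "reading (impulse u) \<theta> = u \<bullet> fst \<theta>"
  using \<alpha>_pos by (simp add: reading_def impulse_def inner_simps power2_eq_square field_simps)

lemma reading_add: "reading (q + q') \<theta> = reading q \<theta> + reading q' \<theta>"
  by (simp add: reading_def inner_simps field_simps add_divide_distrib diff_divide_distrib)

text \<open>Pulls a functional back by one step. The last two terms are the gradient fluctuation
  seen through \<open>fst q\<close>; they cancel when \<open>g\<close> is the mean gradient.\<close>

lemma reading_grad_step: "reading q (grad_step g \<theta>) = reading (mean_step q) \<theta> + fst q \<bullet> h (fst \<theta>) - fst q \<bullet> g"
  using \<alpha>_pos h_sym[of "fst q" "fst \<theta>"] h_sym[of "fst q" "snd \<theta>"]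
  by (simp add: reading_def grad_step_def mean_step_def inner_simps power2_eq_square field_simps)

end

section \<open>Moments of a single sample\<close>

lemma integrable_wsecond_form:
  assumes "\<forall>i j. integrable rho (\<lambda>p. w p * (fst p $ i) * (fst p $ j))"
  shows "integrable rho (\<lambda>p. w p * (fst p \<bullet> u) * (fst p \<bullet> v))"
proof -
  have "(\<lambda>p. w p * (fst p \<bullet> u) * (fst p \<bullet> v)) =
    (\<lambda>p. \<Sum>i\<in>UNIV. \<Sum>j\<in>UNIV. u $ i * v $ j * (w p * (fst p $ i) * (fst p $ j)))"
    by (simp add: inner_vec_def sum_product sum_distrib_left mult_ac)
  then show ?thesis
    using assms by (auto intro!: Bochner_Integration.integrable_sum integrable_mult_right)
qed

lemma wsecond_form:
  assumes "\<forall>i j. integrable rho (\<lambda>p. w p * (fst p $ i) * (fst p $ j))"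
  shows "u \<bullet> (wsecond rho w *v v) = (\<integral>p. w p * (fst p \<bullet> u) * (fst p \<bullet> v) \<partial>rho)"
proof -
  have "u \<bullet> (wsecond rho w *v v) =
    (\<Sum>i\<in>UNIV. \<Sum>j\<in>UNIV. u $ i * v $ j * (\<integral>p. w p * (fst p $ i) * (fst p $ j) \<partial>rho))"
    by (simp add: wsecond_def inner_vec_def matrix_vector_mult_def sum_distrib_left mult_ac)
  also have "\<dots> = (\<integral>p. (\<Sum>i\<in>UNIV. \<Sum>j\<in>UNIV. u $ i * v $ j * (w p * (fst p $ i) * (fst p $ j))) \<partial>rho)"
    using assms by (simp add: Bochner_Integration.integral_sum Bochner_Integration.integrable_sum)
  also have "\<dots> = (\<integral>p. w p * (fst p \<bullet> u) * (fst p \<bullet> v) \<partial>rho)"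
    by (simp add: inner_vec_def sum_product sum_distrib_left mult_ac)
  finally show ?thesis .
qed

lemma abs_mult_le_sum_squares: "\<bar>x * y\<bar> \<le> (x\<^sup>2 + y\<^sup>2 :: real)"
proof -
  have "2 * \<bar>x * y\<bar> \<le> x\<^sup>2 + y\<^sup>2"
    using sum_squares_bound[of "\<bar>x\<bar>" "\<bar>y\<bar>"] by (simp add: abs_mult)
  then show ?thesis using sum_power2_ge_zero[of x y] by linarith
qed

text \<open>That the matrices in (i) to (iii) are finite is expressed by integrability of their
  entries: the integral of a non-integrable function is 0, so the Loewner bounds alone would not
  express it.\<close>

locale least_squares = prob_space rho for rho :: "('d::finite) sample measure" +
  fixes xs :: "real ^ 'd" and R \<sigma> \<kappa> \<alpha> \<beta> :: real and H :: "real ^ 'd ^ 'd"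
  defines "H \<equiv> wsecond rho (\<lambda>p. 1)"
  assumes sets_rho: "sets rho = sets borel"
    and int_a: "integrable rho (\<lambda>p. (norm (fst p))^2)"
    and int_b: "integrable rho (\<lambda>p. (snd p)^2)"
    and H_inv: "invertible H"
    and xs_min: "\<forall>x. risk rho xs \<le> risk rho x"
    and int_i: "\<forall>i j. integrable rho (\<lambda>p. (norm (fst p))^2 * (fst p $ i) * (fst p $ j))"
    and int_ii: "\<forall>i j. integrable rho (\<lambda>p. (snd p - xs \<bullet> fst p)^2 * (fst p $ i) * (fst p $ j))"
    and int_iii: "\<forall>i j. integrable rho
                    (\<lambda>p. (fst p \<bullet> (matrix_inv H *v fst p)) * (fst p $ i) * (fst p $ j))"
    and cond_i: "loewner_le (wsecond rho (\<lambda>p. (norm (fst p))^2)) (R^2 *\<^sub>R H)"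
    and cond_ii: "loewner_le (wsecond rho (\<lambda>p. (snd p - xs \<bullet> fst p)^2)) (\<sigma>^2 *\<^sub>R H)"
    and cond_iii: "loewner_le (wsecond rho (\<lambda>p. fst p \<bullet> (matrix_inv H *v fst p))) (\<kappa> *\<^sub>R H)"
    and \<alpha>_pos: "\<alpha> > 0" and \<beta>_pos: "\<beta> > 0"
    and step1: "(\<alpha> + 2 * \<beta>) * R^2 \<le> 1"
    and step2: "\<alpha> \<le> \<beta> / (2 * \<kappa>)"
begin

lemma measurable_rho: "measurable rho M = measurable (borel \<Otimes>\<^sub>M borel) M"
  by (rule measurable_cong_sets) (simp_all only: sets_rho borel_prod)

lemma measurable_fst_rho [measurable]: "fst \<in> rho \<rightarrow>\<^sub>M borel"
  by (simp add: measurable_rho)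

lemma measurable_snd_rho [measurable]: "snd \<in> rho \<rightarrow>\<^sub>M borel"
  by (simp add: measurable_rho)

definition noise :: "'d sample \<Rightarrow> real" where
  "noise p = snd p - xs \<bullet> fst p"

lemma measurable_noise [measurable]: "noise \<in> borel_measurable rho"
  unfolding noise_def by measurable

definition hi :: "real ^ 'd \<Rightarrow> real ^ 'd" where
  "hi x = matrix_inv H *v x"

lemma H_inverse: "H ** matrix_inv H = mat 1" "matrix_inv H ** H = mat 1"
  using H_inv someI_ex[of "\<lambda>A. H ** A = mat 1 \<and> A ** H = mat 1"]
  by (auto simp: invertible_def matrix_inv_def)

lemma H_hi: "H *v (hi x) = x"
  using H_inverse by (simp add: hi_def matrix_vector_mul_assoc)

lemma hi_H: "hi (H *v x) = x"
  using H_inverse by (simp add: hi_def matrix_vector_mul_assoc)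

lemma integrable_second: "integrable rho (\<lambda>p. (fst p \<bullet> u) * (fst p \<bullet> v))"
proof (rule Bochner_Integration.integrable_bound)
  show "integrable rho (\<lambda>p. (norm (fst p))\<^sup>2 * (norm u * norm v))"
    using int_a by simp
  show "AE p in rho. norm ((fst p \<bullet> u) * (fst p \<bullet> v)) \<le> norm ((norm (fst p))\<^sup>2 * (norm u * norm v))"
  proof (rule AE_I2)
    fix p
    have "\<bar>fst p \<bullet> u\<bar> * \<bar>fst p \<bullet> v\<bar> \<le> (norm (fst p) * norm u) * (norm (fst p) * norm v)"
      by (intro mult_mono Cauchy_Schwarz_ineq2) auto
    then show "norm ((fst p \<bullet> u) * (fst p \<bullet> v)) \<le> norm ((norm (fst p))\<^sup>2 * (norm u * norm v))"
      by (simp add: abs_mult power2_eq_square mult_ac)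
  qed
qed measurable

lemma H_form: "u \<bullet> (H *v v) = (\<integral>p. (fst p \<bullet> u) * (fst p \<bullet> v) \<partial>rho)"
proof -
  have "\<forall>i j. integrable rho (\<lambda>p. 1 * (fst p $ i) * (fst p $ j))"
    using integrable_second[of "axis _ 1" "axis _ 1"] by (simp add: inner_axis)
  from wsecond_form[OF this] show ?thesis
    unfolding H_def by simp
qed

lemma H_sym: "(H *v x) \<bullet> y = x \<bullet> (H *v y)"
  by (subst inner_commute) (simp add: H_form mult.commute)

lemma H_nonneg: "0 \<le> x \<bullet> (H *v x)"
  by (simp add: H_form)

section \<open>Quadratic form versions of the moment conditions, and properties of
  \<open>H\<close>\<close>

lemma integrable_norm_second:
  "integrable rho (\<lambda>p. (norm (fst p))\<^sup>2 * (fst p \<bullet> u)\<^sup>2)"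
  using integrable_wsecond_form[OF int_i, of u u] by (simp add: power2_eq_square mult.assoc)

lemma integral_norm_second_le:
  "(\<integral>p. (norm (fst p))\<^sup>2 * (fst p \<bullet> u)\<^sup>2 \<partial>rho) \<le> R\<^sup>2 * (u \<bullet> (H *v u))"
  using cond_i[unfolded loewner_le_def, rule_format, of u] wsecond_form[OF int_i, of u u]
  by (simp add: power2_eq_square mult.assoc scaleR_matrix_vector_assoc[symmetric])

lemma integrable_noise_second:
  "integrable rho (\<lambda>p. (noise p)\<^sup>2 * (fst p \<bullet> u)\<^sup>2)"
  using integrable_wsecond_form[OF int_ii, of u u]
  by (simp add: power2_eq_square mult.assoc noise_def)

lemma integral_noise_second_le:
  "(\<integral>p. (noise p)\<^sup>2 * (fst p \<bullet> u)\<^sup>2 \<partial>rho) \<le> \<sigma>\<^sup>2 * (u \<bullet> (H *v u))"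
  using cond_ii[unfolded loewner_le_def, rule_format, of u] wsecond_form[OF int_ii, of u u]
  by (simp add: power2_eq_square mult.assoc scaleR_matrix_vector_assoc[symmetric] noise_def)

lemma integrable_hi_second:
  "integrable rho (\<lambda>p. (fst p \<bullet> hi (fst p)) * (fst p \<bullet> u)\<^sup>2)"
  using integrable_wsecond_form[OF int_iii, of u u]
  by (simp add: power2_eq_square mult.assoc hi_def)

lemma integral_hi_second_le:
  "(\<integral>p. (fst p \<bullet> hi (fst p)) * (fst p \<bullet> u)\<^sup>2 \<partial>rho) \<le> \<kappa> * (u \<bullet> (H *v u))"
  using cond_iii[unfolded loewner_le_def, rule_format, of u] wsecond_form[OF int_iii, of u u]
  by (simp add: power2_eq_square mult.assoc scaleR_matrix_vector_assoc[symmetric] hi_def)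

lemma integrable_fourth:
  "integrable rho (\<lambda>p. (fst p \<bullet> u)\<^sup>2 * (fst p \<bullet> v)\<^sup>2)"
proof (rule Bochner_Integration.integrable_bound)
  show "integrable rho (\<lambda>p. (norm u)\<^sup>2 * ((norm (fst p))\<^sup>2 * (fst p \<bullet> v)\<^sup>2))"
    using integrable_norm_second by simp
  show "AE p in rho. norm ((fst p \<bullet> u)\<^sup>2 * (fst p \<bullet> v)\<^sup>2)
      \<le> norm ((norm u)\<^sup>2 * ((norm (fst p))\<^sup>2 * (fst p \<bullet> v)\<^sup>2))"
  proof (rule AE_I2)
    fix p
    have "(fst p \<bullet> u)\<^sup>2 \<le> (norm (fst p) * norm u)\<^sup>2"
      using Cauchy_Schwarz_ineq2[of "fst p" u] abs_le_square_iff[of "fst p \<bullet> u" "norm (fst p) * norm u"] by simp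
    then have "(fst p \<bullet> u)\<^sup>2 * (fst p \<bullet> v)\<^sup>2 \<le> (norm (fst p) * norm u)\<^sup>2 * (fst p \<bullet> v)\<^sup>2"
      by (rule mult_right_mono) simp
    then show "norm ((fst p \<bullet> u)\<^sup>2 * (fst p \<bullet> v)\<^sup>2)
      \<le> norm ((norm u)\<^sup>2 * ((norm (fst p))\<^sup>2 * (fst p \<bullet> v)\<^sup>2))"
      by (simp add: abs_mult power_mult_distrib mult_ac)
  qed
qed measurable

text \<open>Jensen's inequality for the random vector a (a, x), whose mean is H x.\<close>

lemma H_upper: "(H *v x) \<bullet> (H *v x) \<le> R\<^sup>2 * (x \<bullet> (H *v x))"
proof -
  let ?u = "H *v x"
  have "0 \<le> (\<integral>p. (norm ((fst p \<bullet> x) *\<^sub>R fst p - ?u))\<^sup>2 \<partial>rho)"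
    by simp
  also have "\<dots> = (\<integral>p. (norm (fst p))\<^sup>2 * (fst p \<bullet> x)\<^sup>2 - 2 * ((fst p \<bullet> x) * (fst p \<bullet> ?u)) + ?u \<bullet> ?u \<partial>rho)"
    unfolding power2_norm_eq_inner
    by (rule Bochner_Integration.integral_cong)
      (simp_all add: inner_simps inner_commute power2_eq_square algebra_simps)
  also have "\<dots> = (\<integral>p. (norm (fst p))\<^sup>2 * (fst p \<bullet> x)\<^sup>2 \<partial>rho) - 2 * (x \<bullet> (H *v ?u)) + ?u \<bullet> ?u"
    using integrable_norm_second[of x] integrable_second[of x ?u]
    by (simp add: H_form prob_space)
  also have "x \<bullet> (H *v ?u) = ?u \<bullet> ?u"
    by (simp add: H_sym)
  finally show ?thesis
    using integral_norm_second_le[of x] by simp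
qed

lemma H_pos: "x \<noteq> 0 \<Longrightarrow> 0 < x \<bullet> (H *v x)"
proof (rule ccontr)
  assume x: "x \<noteq> 0" and "\<not> 0 < x \<bullet> (H *v x)"
  then have "x \<bullet> (H *v x) = 0" using H_nonneg[of x] by simp
  then have "(H *v x) \<bullet> (H *v x) \<le> 0" using H_upper[of x] by simp
  then have "H *v x = 0" by (metis inner_ge_zero inner_eq_zero_iff order_antisym)
  then have "hi (H *v x) = 0" by (simp add: hi_def)
  then show False using x by (simp add: hi_H)
qed

text \<open>Cauchy-Schwarz in the inner product given by \<open>H\<close>, for the vectors
  \<open>hi a\<close> and \<open>w\<close>; \<open>c\<close> is the projection coefficient.\<close>

lemma inner_le_hi_form: "(a \<bullet> w)\<^sup>2 \<le> (a \<bullet> hi a) * (w \<bullet> (H *v w))"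
proof (cases "w = 0")
  case False
  define c where "c = (a \<bullet> w) / (w \<bullet> (H *v w))"
  have pos: "0 < w \<bullet> (H *v w)" using False by (rule H_pos)
  have "0 \<le> (hi a - c *\<^sub>R w) \<bullet> (H *v (hi a - c *\<^sub>R w))"
    by (rule H_nonneg)
  also have "\<dots> = a \<bullet> hi a - 2 * c * (a \<bullet> w) + c\<^sup>2 * (w \<bullet> (H *v w))"
    using H_sym[of w "hi a"] H_sym[of "hi a" w]
    by (simp add: matrix_vector_mult_diff_distrib matrix_vector_mult_scaleR H_hi inner_simps
      inner_commute power2_eq_square algebra_simps)
  also have "\<dots> = a \<bullet> hi a - (a \<bullet> w)\<^sup>2 / (w \<bullet> (H *v w))"
    using pos by (simp add: c_def field_simps power2_eq_square)
  finally show ?thesis using pos by (simp add: field_simps)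
qed simp

lemma kappa_ge_1: "1 \<le> \<kappa>"
proof -
  \<comment> \<open>With \<open>y = (a, w)\<^sup>2\<close> and \<open>q\<close> its mean: \<open>y\<^sup>2 / q \<ge> 2 y - q\<close>.\<close>
  obtain w :: "real ^ 'd" where w: "w \<noteq> 0" by (metis axis_eq_0_iff zero_neq_one)
  let ?q = "w \<bullet> (H *v w)"
  have pos: "0 < ?q" using w by (rule H_pos)
  have "?q = (\<integral>p. 2 * ((fst p \<bullet> w) * (fst p \<bullet> w)) - ?q \<partial>rho)"
    using integrable_second[of w w] H_form[of w w] by (simp add: prob_space)
  also have "\<dots> \<le> (\<integral>p. (fst p \<bullet> hi (fst p)) * (fst p \<bullet> w)\<^sup>2 \<partial>rho)"
  proof (rule integral_mono)
    fix p
    let ?y = "(fst p \<bullet> w)\<^sup>2"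
    have "(2 * ?y - ?q) * ?q \<le> ?y * ?y"
      using zero_le_power2[of "?y - ?q"] by (simp add: power2_eq_square algebra_simps)
    also have "\<dots> \<le> ((fst p \<bullet> hi (fst p)) * ?q) * ?y"
      by (intro mult_right_mono inner_le_hi_form) simp
    finally have "(2 * ?y - ?q) * ?q \<le> ((fst p \<bullet> hi (fst p)) * ?y) * ?q"
      by (simp add: mult_ac)
    then show "2 * ((fst p \<bullet> w) * (fst p \<bullet> w)) - ?q \<le> (fst p \<bullet> hi (fst p)) * (fst p \<bullet> w)\<^sup>2"
      using pos by (simp add: power2_eq_square)
  qed (use integrable_second[of w w] integrable_hi_second[of w] in auto)
  also have "\<dots> \<le> \<kappa> * ?q"
    by (rule integral_hi_second_le)
  finally show ?thesis using pos by simp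
qed

lemma step_\<kappa>: "2 * \<alpha> * \<kappa> \<le> \<beta>"
  using step2 kappa_ge_1 by (simp add: field_simps)

text \<open>Here 1 \<le> \<kappa> turns the bound on \<alpha> \<kappa> into 2 \<alpha> \<le>
  \<beta>, and \<open>H_upper\<close> supplies the smoothness bound with L = R^2.\<close>

sublocale accelerated_system "\<lambda>x. H *v x" hi "R\<^sup>2" \<alpha> \<beta>
proof
  show "2 * \<alpha> \<le> \<beta>"
  proof -
    have "2 * \<alpha> * 1 \<le> 2 * \<alpha> * \<kappa>"
      using kappa_ge_1 \<alpha>_pos by (intro mult_left_mono) auto
    then show ?thesis using step_\<kappa> by simp
  qed
qed (use H_sym H_nonneg H_hi hi_H H_upper \<alpha>_pos \<beta>_pos step1 in
    \<open>auto simp: matrix_vector_right_distrib matrix_vector_mult_scaleR\<close>)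

lemma integrable_potential_second:
  "integrable rho (\<lambda>p. potential (impulse (fst p)) * (fst p \<bullet> u)\<^sup>2)"
  using integrable_norm_second[of u] integrable_hi_second[of u]
  by (simp add: potential_impulse power2_norm_eq_inner distrib_left distrib_right mult.assoc)

text \<open>Condition (iii) handles the \<open>hi\<close> part and condition (i) the norm part of S;
  the step sizes make each share at most 1/2. The factor 2/3 left over is below 1, which keeps the
  feedback of the multiplicative noise summable.\<close>

lemma integral_potential_second_le:
  "(\<integral>p. potential (impulse (fst p)) * (fst p \<bullet> u)\<^sup>2 \<partial>rho) \<le> 2/3 * (u \<bullet> (H *v u))"
proof -
  let ?q = "u \<bullet> (H *v u)"
  have "(\<integral>p. potential (impulse (fst p)) * (fst p \<bullet> u)\<^sup>2 \<partial>rho) =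
     (\<integral>p. 2/3 * (\<alpha> / \<beta>) * ((fst p \<bullet> hi (fst p)) * (fst p \<bullet> u)\<^sup>2)
       + 2/3 * (\<beta> + \<alpha> / 2) * ((norm (fst p))\<^sup>2 * (fst p \<bullet> u)\<^sup>2) \<partial>rho)"
    by (rule Bochner_Integration.integral_cong)
      (simp_all add: potential_impulse power2_norm_eq_inner distrib_left distrib_right mult.assoc)
  also have "\<dots> = 2/3 * (\<alpha> / \<beta>) * (\<integral>p. (fst p \<bullet> hi (fst p)) * (fst p \<bullet> u)\<^sup>2 \<partial>rho)
       + 2/3 * (\<beta> + \<alpha> / 2) * (\<integral>p. (norm (fst p))\<^sup>2 * (fst p \<bullet> u)\<^sup>2 \<partial>rho)"
    using integrable_norm_second[of u] integrable_hi_second[of u] by simp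
  also have "\<dots> \<le> 2/3 * (\<alpha> / \<beta>) * (\<kappa> * ?q) + 2/3 * (\<beta> + \<alpha> / 2) * (R\<^sup>2 * ?q)"
    using integral_hi_second_le integral_norm_second_le \<alpha>_pos \<beta>_pos
    by (intro add_mono mult_left_mono) auto
  also have "\<dots> = (\<alpha> * \<kappa> / \<beta> + (\<beta> + \<alpha> / 2) * R\<^sup>2) * (2/3 * ?q)"
    by (simp add: algebra_simps)
  also have "\<dots> \<le> 1 * (2/3 * ?q)"
  proof (intro mult_right_mono)
    have "\<alpha> * \<kappa> / \<beta> \<le> 1/2" using step_\<kappa> \<beta>_pos by (simp add: field_simps)
    moreover have "(\<beta> + \<alpha> / 2) * R\<^sup>2 \<le> 1/2" using step1 by (simp add: algebra_simps)
    ultimately show "\<alpha> * \<kappa> / \<beta> + (\<beta> + \<alpha> / 2) * R\<^sup>2 \<le> 1" by linarith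
  qed (simp add: H_nonneg)
  finally show ?thesis by simp
qed

text \<open>The mean is the trace of H times its inverse, computed in the standard basis. This is
  where the dimension in the bound comes from.\<close>

lemma integral_hi_form: "integrable rho (\<lambda>p. fst p \<bullet> hi (fst p))"
    "(\<integral>p. fst p \<bullet> hi (fst p) \<partial>rho) = real CARD('d)"
proof -
  have e: "fst p \<bullet> hi (fst p) = (\<Sum>i\<in>UNIV. (fst p \<bullet> axis i 1) * (fst p \<bullet> hi (axis i 1)))" for p :: "'d sample"
  proof -
    have "fst p \<bullet> hi (fst p) = (\<Sum>i\<in>UNIV. fst p $ i * hi (fst p) $ i)"
      by (simp add: inner_vec_def)
    also have "\<dots> = (\<Sum>i\<in>UNIV. (fst p \<bullet> axis i 1) * (hi (fst p) \<bullet> axis i 1))"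
      by (simp add: inner_axis)
    finally show ?thesis by (simp add: hi_sym)
  qed
  have i: "integrable rho (\<lambda>p. (fst p \<bullet> axis i 1) * (fst p \<bullet> hi (axis i 1)))" for i
    by (rule integrable_second)
  show "integrable rho (\<lambda>p. fst p \<bullet> hi (fst p))"
    unfolding e using i by (intro Bochner_Integration.integrable_sum) auto
  have "(\<integral>p. fst p \<bullet> hi (fst p) \<partial>rho) = (\<Sum>i\<in>UNIV. axis i 1 \<bullet> (H *v hi (axis i 1)))"
    unfolding e H_form using i by (intro Bochner_Integration.integral_sum) auto
  also have "\<dots> = real CARD('d)"
    by (simp add: H_hi inner_axis_axis)
  finally show "(\<integral>p. fst p \<bullet> hi (fst p) \<partial>rho) = real CARD('d)" .
qed

section \<open>Label noise and excess risk\<close>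

lemma integrable_noise_sq: "integrable rho (\<lambda>p. (noise p)\<^sup>2)"
proof (rule Bochner_Integration.integrable_bound)
  show "integrable rho (\<lambda>p. 2 * (snd p)\<^sup>2 + 2 * ((fst p \<bullet> xs) * (fst p \<bullet> xs)))"
    using int_b integrable_second[of xs xs] by simp
  show "AE p in rho. norm ((noise p)\<^sup>2) \<le> norm (2 * (snd p)\<^sup>2 + 2 * ((fst p \<bullet> xs) * (fst p \<bullet> xs)))"
  proof (rule AE_I2)
    fix p
    have "(noise p)\<^sup>2 \<le> 2 * (snd p)\<^sup>2 + 2 * (fst p \<bullet> xs)\<^sup>2"
      using zero_le_power2[of "snd p + fst p \<bullet> xs"]
      by (simp add: noise_def inner_commute power2_eq_square algebra_simps)
    then show "norm ((noise p)\<^sup>2) \<le> norm (2 * (snd p)\<^sup>2 + 2 * ((fst p \<bullet> xs) * (fst p \<bullet> xs)))"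
      by (simp add: power2_eq_square)
  qed
qed measurable

lemma integrable_noise_first: "integrable rho (\<lambda>p. noise p * (fst p \<bullet> u))"
proof (rule Bochner_Integration.integrable_bound)
  show "integrable rho (\<lambda>p. (noise p)\<^sup>2 + (fst p \<bullet> u)\<^sup>2)"
    using integrable_noise_sq integrable_second[of u u] by (simp add: power2_eq_square)
  show "AE p in rho. norm (noise p * (fst p \<bullet> u)) \<le> norm ((noise p)\<^sup>2 + (fst p \<bullet> u)\<^sup>2)"
    using abs_mult_le_sum_squares by (intro AE_I2) simp
qed measurable

lemma risk_expansion:
  "risk rho (xs + v) = risk rho xs - (\<integral>p. noise p * (fst p \<bullet> v) \<partial>rho) + 1/2 * (v \<bullet> (H *v v))"
proof -
  have "risk rho (xs + v) = 1/2 * (\<integral>p. (noise p)\<^sup>2 - 2 * (noise p * (fst p \<bullet> v)) + (fst p \<bullet> v) * (fst p \<bullet> v) \<partial>rho)"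
    unfolding risk_def noise_def
    by (intro arg_cong2[where f="(*)"] Bochner_Integration.integral_cong)
      (simp_all add: inner_simps inner_commute power2_eq_square algebra_simps)
  moreover have "risk rho xs = 1/2 * (\<integral>p. (noise p)\<^sup>2 \<partial>rho)"
    unfolding risk_def noise_def by (simp add: power2_commute)
  ultimately show ?thesis
    using integrable_noise_sq integrable_noise_first[of v] integrable_second[of v v]
    by (simp add: H_form)
qed

text \<open>First order optimality of \<open>xs\<close>: moving by c u changes the risk by q c^2 / 2
  - c m, which must never be negative.\<close>

lemma integral_noise_first: "(\<integral>p. noise p * (fst p \<bullet> u) \<partial>rho) = 0"
proof -
  define m where "m = (\<integral>p. noise p * (fst p \<bullet> u) \<partial>rho)"
  define q where "q = u \<bullet> (H *v u)"
  have q: "0 \<le> q" unfolding q_def by (rule H_nonneg)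
  have *: "c * m \<le> 1/2 * c\<^sup>2 * q" for c
  proof -
    have "(\<integral>p. noise p * (fst p \<bullet> (c *\<^sub>R u)) \<partial>rho) = c * m"
      unfolding m_def by (simp add: mult.left_commute)
    moreover have "(c *\<^sub>R u) \<bullet> (H *v (c *\<^sub>R u)) = c\<^sup>2 * q"
      by (simp add: q_def matrix_vector_mult_scaleR power2_eq_square)
    ultimately show ?thesis
      using xs_min[rule_format, of "xs + c *\<^sub>R u"] risk_expansion[of "c *\<^sub>R u"] by simp
  qed
  \<comment> \<open>The best c would be m/q, but q may be 0. With q + 1 in its place the inequality
    still reads c m \<le> c m / 2.\<close>
  have "(m / (q + 1)) * m \<le> 1/2 * (m / (q + 1))\<^sup>2 * q"
    by (rule *)
  also have "\<dots> \<le> 1/2 * (m / (q + 1))\<^sup>2 * (q + 1)"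
    by (intro mult_left_mono) auto
  also have "\<dots> = 1/2 * ((m / (q + 1)) * m)"
  proof -
    have "q + 1 \<noteq> 0" using q by linarith
    then show ?thesis by (simp add: power2_eq_square)
  qed
  finally have "(m / (q + 1)) * m \<le> 0" by linarith
  then have "m * m \<le> 0" using q by (simp add: field_simps mult_le_0_iff)
  then show ?thesis
    unfolding m_def[symmetric] by (auto simp: mult_le_0_iff)
qed

lemma risk_excess: "risk rho x = risk rho xs + 1/2 * ((x - xs) \<bullet> (H *v (x - xs)))"
  using risk_expansion[of "x - xs"] by (simp add: integral_noise_first)

end

section \<open>Sample streams\<close>

abbreviation samples :: "'a measure \<Rightarrow> (nat \<Rightarrow> 'a) measure" where
  "samples M \<equiv> PiM UNIV (\<lambda>_. M)"

lemma measurable_comb_stream: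
  assumes "(\<lambda>(\<omega>, s). F \<omega> s) \<in> (samples M) \<Otimes>\<^sub>M M \<rightarrow>\<^sub>M N"
  shows "(\<lambda>\<omega>. F \<omega> (\<omega> t)) \<in> (samples M) \<rightarrow>\<^sub>M N"
  using measurable_compose[OF _ assms, of "\<lambda>\<omega>. (\<omega>, \<omega> t)" "samples M"] by simp

context prob_space
begin

lemma prob_space_stream: "prob_space (samples M)"
  by (intro prob_space_PiM prob_space_axioms)

text \<open>Splitting the stream at time t and resampling its tail replaces the sample at time t by an
  independent one.\<close>

lemma distr_stream_split:
  fixes F :: "(nat \<Rightarrow> 'a) \<Rightarrow> 'a \<Rightarrow> 'b"
  assumes dep: "\<And>\<omega> \<omega>' s. (\<And>i. i < t \<Longrightarrow> \<omega> i = \<omega>' i) \<Longrightarrow> F \<omega> s = F \<omega>' s"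
    and meas: "(\<lambda>(\<omega>, s). F \<omega> s) \<in> (samples M) \<Otimes>\<^sub>M M \<rightarrow>\<^sub>M N"
  shows "distr (samples M) N (\<lambda>\<omega>. F \<omega> (\<omega> t)) = distr (samples M \<Otimes>\<^sub>M M) N (\<lambda>(\<omega>, s). F \<omega> s)"
proof -
  have sf: "sigma_finite_measure M"
    by (intro prob_space_imp_sigma_finite prob_space_axioms)
  interpret sequence_space M
    by unfold_locales
  have comb: "F (comb_seq t \<omega> \<omega>') (comb_seq t \<omega> \<omega>' t) = F \<omega> (\<omega>' 0)" for \<omega> \<omega>'
    using dep[of "comb_seq t \<omega> \<omega>'" \<omega>] by (simp add: comb_seq_def)
  have "distr (samples M) N (\<lambda>\<omega>. F \<omega> (\<omega> t))
      = distr (distr (samples M \<Otimes>\<^sub>M (samples M)) (samples M) (\<lambda>(\<omega>, \<omega>'). comb_seq t \<omega> \<omega>')) N (\<lambda>\<omega>. F \<omega> (\<omega> t))"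
    by (simp only: PiM_comb_seq)
  also have "\<dots> = distr (samples M \<Otimes>\<^sub>M (samples M)) N (\<lambda>(\<omega>, \<omega>'). F \<omega> (\<omega>' 0))"
    by (subst distr_distr)
      (auto intro!: measurable_comb_stream[OF meas] meas distr_cong measurable_comb_seq simp: comb comp_def)
  also have "\<dots> = distr (distr (samples M \<Otimes>\<^sub>M (samples M)) (samples M \<Otimes>\<^sub>M M) (\<lambda>(\<omega>, \<omega>'). (\<omega>, \<omega>' 0))) N (\<lambda>(\<omega>, s). F \<omega> s)"
    by (subst distr_distr) (auto intro!: meas distr_cong simp: comp_def)
  also have "distr (samples M \<Otimes>\<^sub>M (samples M)) (samples M \<Otimes>\<^sub>M M) (\<lambda>(\<omega>, \<omega>'). (\<omega>, \<omega>' 0))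
      = distr (samples M) (samples M) (\<lambda>\<omega>. \<omega>) \<Otimes>\<^sub>M distr (samples M) M (\<lambda>\<omega>'. \<omega>' 0)"
    by (subst pair_measure_distr)
      (auto simp: PiM_component[of 0] sf)
  also have "\<dots> = (samples M) \<Otimes>\<^sub>M M"
    by (simp add: PiM_component)
  finally show ?thesis .
qed

text \<open>Conditioning on the first \<open>t\<close> samples, as an iterated integral: the past is
  kept and sample \<open>t\<close> is averaged out.\<close>

lemma nn_integral_stream_split:
  fixes F :: "(nat \<Rightarrow> 'a) \<Rightarrow> 'a \<Rightarrow> ennreal"
  assumes dep: "\<And>\<omega> \<omega>' s. (\<And>i. i < t \<Longrightarrow> \<omega> i = \<omega>' i) \<Longrightarrow> F \<omega> s = F \<omega>' s"
    and meas: "(\<lambda>(\<omega>, s). F \<omega> s) \<in> borel_measurable (samples M \<Otimes>\<^sub>M M)"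
  shows "(\<integral>\<^sup>+\<omega>. F \<omega> (\<omega> t) \<partial>samples M) = (\<integral>\<^sup>+\<omega>. \<integral>\<^sup>+s. F \<omega> s \<partial>M \<partial>samples M)"
proof -
  have split: "distr (samples M) borel (\<lambda>\<omega>. F \<omega> (\<omega> t)) = distr (samples M \<Otimes>\<^sub>M M) borel (\<lambda>(\<omega>, s). F \<omega> s)"
    by (rule distr_stream_split[OF _ meas], rule dep, blast)
  have "(\<integral>\<^sup>+\<omega>. F \<omega> (\<omega> t) \<partial>samples M) = (\<integral>\<^sup>+x. x \<partial>distr (samples M) borel (\<lambda>\<omega>. F \<omega> (\<omega> t)))"
    by (subst nn_integral_distr) (auto intro: measurable_comb_stream[OF meas] meas)
  also have "\<dots> = (\<integral>\<^sup>+(\<omega>, s). F \<omega> s \<partial>(samples M \<Otimes>\<^sub>M M))"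
    unfolding split
    by (subst nn_integral_distr) (auto intro: meas)
  also have "\<dots> = (\<integral>\<^sup>+\<omega>. \<integral>\<^sup>+s. F \<omega> s \<partial>M \<partial>samples M)"
    using nn_integral_fst[OF meas] by simp
  finally show ?thesis .
qed

text \<open>The signed version, for conditional means, where integrability has to be
  supplied.\<close>

lemma integral_stream_split:
  fixes F :: "(nat \<Rightarrow> 'a) \<Rightarrow> 'a \<Rightarrow> real"
  assumes dep: "\<And>\<omega> \<omega>' s. (\<And>i. i < t \<Longrightarrow> \<omega> i = \<omega>' i) \<Longrightarrow> F \<omega> s = F \<omega>' s"
    and meas: "(\<lambda>(\<omega>, s). F \<omega> s) \<in> borel_measurable (samples M \<Otimes>\<^sub>M M)"
    and int: "integrable (samples M) (\<lambda>\<omega>. F \<omega> (\<omega> t))"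
  shows "(\<integral>\<omega>. F \<omega> (\<omega> t) \<partial>samples M) = (\<integral>\<omega>. \<integral>s. F \<omega> s \<partial>M \<partial>samples M)"
proof -
  have split: "distr (samples M) borel (\<lambda>\<omega>. F \<omega> (\<omega> t)) = distr (samples M \<Otimes>\<^sub>M M) borel (\<lambda>(\<omega>, s). F \<omega> s)"
    by (rule distr_stream_split[OF _ meas], rule dep, blast)
  interpret SM: pair_sigma_finite "samples M" M
    by (intro pair_sigma_finite.intro prob_space_imp_sigma_finite prob_space_stream prob_space_axioms)
  have "integrable (distr (samples M) borel (\<lambda>\<omega>. F \<omega> (\<omega> t))) (\<lambda>x. x)"
    using int by (subst integrable_distr_eq) (auto intro: measurable_comb_stream[OF meas] meas)
  then have i: "integrable (samples M \<Otimes>\<^sub>M M) (\<lambda>(\<omega>, s). F \<omega> s)"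
    unfolding split
    by (subst (asm) integrable_distr_eq) (auto intro: meas)
  have "(\<integral>\<omega>. F \<omega> (\<omega> t) \<partial>samples M) = (\<integral>x. x \<partial>distr (samples M) borel (\<lambda>\<omega>. F \<omega> (\<omega> t)))"
    by (subst integral_distr) (auto intro: measurable_comb_stream[OF meas] meas)
  also have "\<dots> = (\<integral>(\<omega>, s). F \<omega> s \<partial>(samples M \<Otimes>\<^sub>M M))"
    unfolding split
    by (subst integral_distr) (auto intro: meas)
  also have "\<dots> = (\<integral>\<omega>. \<integral>s. F \<omega> s \<partial>M \<partial>samples M)"
    using SM.integral_fst'[OF i] by simp
  finally show ?thesis .
qed

end

lemma measurable_fst_borel:
  fixes f :: "'a \<Rightarrow> 'b::topological_space \<times> 'c::topological_space"
  shows "f \<in> M \<rightarrow>\<^sub>M borel \<Longrightarrow> (\<lambda>x. fst (f x)) \<in> M \<rightarrow>\<^sub>M borel"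
  by (erule measurable_compose) (intro borel_measurable_continuous_onI continuous_intros)

lemma measurable_snd_borel:
  fixes f :: "'a \<Rightarrow> 'b::topological_space \<times> 'c::topological_space"
  shows "f \<in> M \<rightarrow>\<^sub>M borel \<Longrightarrow> (\<lambda>x. snd (f x)) \<in> M \<rightarrow>\<^sub>M borel"
  by (erule measurable_compose) (intro borel_measurable_continuous_onI continuous_intros)

lemma nn_integral_affine:
  assumes "prob_space M" "f \<in> borel_measurable M" "g \<in> borel_measurable M"
  shows "(\<integral>\<^sup>+x. c + (a * f x + b * g x) \<partial>M) = c + (a * (\<integral>\<^sup>+x. f x \<partial>M) + b * (\<integral>\<^sup>+x. g x \<partial>M))"
  using assms by (simp add: nn_integral_add nn_integral_cmult prob_space.emeasure_space_1)

section \<open>The bias process\<close>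

context least_squares
begin

section \<open>Mean cost after one random gradient step\<close>

lemma integral_fst_inner_scaled:
  fixes g :: "real ^ 'd \<Rightarrow> real ^ 'd"
  assumes g: "linear g"
  shows "integrable rho (\<lambda>p. (fst p \<bullet> u) * (c \<bullet> g (fst p)))"
    and "(\<integral>p. (fst p \<bullet> u) * (c \<bullet> g (fst p)) \<partial>rho) = c \<bullet> g (H *v u)"
proof -
  have e: "c \<bullet> g x = x \<bullet> adjoint g c" for x
    using adjoint_works[OF g, of x c] by (simp add: inner_commute)
  show "integrable rho (\<lambda>p. (fst p \<bullet> u) * (c \<bullet> g (fst p)))"
    unfolding e by (rule integrable_second)
  show "(\<integral>p. (fst p \<bullet> u) * (c \<bullet> g (fst p)) \<partial>rho) = c \<bullet> g (H *v u)"
    unfolding e H_form[symmetric] by (simp add: H_sym)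
qed

text \<open>With X = (a, u) g(a), whose mean is g (H u), the mean square of c - X is the square of
  its mean plus a variance, and the variance is at most the second moment of X. The map
  \<open>g\<close> will be the response some steps after an impulse along a.\<close>

lemma
  fixes g :: "real ^ 'd \<Rightarrow> real ^ 'd"
  assumes g: "linear g"
  shows integrable_second_form: "integrable rho (\<lambda>p. (fst p \<bullet> u)\<^sup>2 * (g (fst p) \<bullet> (H *v g (fst p))))"
    and integrable_perturbed_form:
      "integrable rho (\<lambda>p. (c - (fst p \<bullet> u) *\<^sub>R g (fst p)) \<bullet> (H *v (c - (fst p \<bullet> u) *\<^sub>R g (fst p))))"
    and integral_perturbed_form_le:
      "(\<integral>p. (c - (fst p \<bullet> u) *\<^sub>R g (fst p)) \<bullet> (H *v (c - (fst p \<bullet> u) *\<^sub>R g (fst p))) \<partial>rho)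
        \<le> (c - g (H *v u)) \<bullet> (H *v (c - g (H *v u)))
          + (\<integral>p. (fst p \<bullet> u)\<^sup>2 * (g (fst p) \<bullet> (H *v g (fst p))) \<partial>rho)"
proof -
  obtain B where B: "\<And>x. norm (g x) \<le> B * norm x"
    using linear_bounded[OF g] by blast
  have meas: "(\<lambda>p. g (fst p)) \<in> borel_measurable rho"
    using measurable_compose[OF measurable_fst_rho borel_measurable_continuous_onI[OF linear_continuous_on[OF linear_conv_bounded_linear[THEN iffD1, OF g]]]]
    by simp
  have meas_H: "(\<lambda>p. H *v g (fst p)) \<in> borel_measurable rho"
    using measurable_compose[OF meas borel_measurable_continuous_onI[OF linear_continuous_on[OF linear_conv_bounded_linear[THEN iffD1, OF linear_h]]]]
    by simp
  show form: "integrable rho (\<lambda>p. (fst p \<bullet> u)\<^sup>2 * (g (fst p) \<bullet> (H *v g (fst p))))"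
  proof (rule Bochner_Integration.integrable_bound)
    show "integrable rho (\<lambda>p. R\<^sup>2 * B\<^sup>2 * ((norm (fst p))\<^sup>2 * (fst p \<bullet> u)\<^sup>2))"
      using integrable_norm_second by simp
    show "AE p in rho. norm ((fst p \<bullet> u)\<^sup>2 * (g (fst p) \<bullet> (H *v g (fst p))))
      \<le> norm (R\<^sup>2 * B\<^sup>2 * ((norm (fst p))\<^sup>2 * (fst p \<bullet> u)\<^sup>2))"
    proof (rule AE_I2)
      fix p
      have "(norm (g (fst p)))\<^sup>2 \<le> (B * norm (fst p))\<^sup>2"
        by (intro power_mono B) simp
      then have "R\<^sup>2 * (g (fst p) \<bullet> g (fst p)) \<le> R\<^sup>2 * (B * norm (fst p))\<^sup>2"
        by (intro mult_left_mono) (auto simp: power2_norm_eq_inner)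
      then have "g (fst p) \<bullet> (H *v g (fst p)) \<le> R\<^sup>2 * (B * norm (fst p))\<^sup>2"
        using h_form_le_norm[of "g (fst p)"] by linarith
      then have "(fst p \<bullet> u)\<^sup>2 * (g (fst p) \<bullet> (H *v g (fst p))) \<le> (fst p \<bullet> u)\<^sup>2 * (R\<^sup>2 * (B * norm (fst p))\<^sup>2)"
        by (intro mult_left_mono) auto
      then show "norm ((fst p \<bullet> u)\<^sup>2 * (g (fst p) \<bullet> (H *v g (fst p))))
        \<le> norm (R\<^sup>2 * B\<^sup>2 * ((norm (fst p))\<^sup>2 * (fst p \<bullet> u)\<^sup>2))"
        using H_nonneg[of "g (fst p)"] by (simp add: abs_mult power_mult_distrib mult_ac)
    qed
  qed (use meas meas_H in measurable)
  have e: "(c - (fst p \<bullet> u) *\<^sub>R g (fst p)) \<bullet> (H *v (c - (fst p \<bullet> u) *\<^sub>R g (fst p)))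
     = c \<bullet> (H *v c) - 2 * ((fst p \<bullet> u) * ((H *v c) \<bullet> g (fst p))) + (fst p \<bullet> u)\<^sup>2 * (g (fst p) \<bullet> (H *v g (fst p)))" for p
    using H_sym[of c "g (fst p)"] H_sym[of "g (fst p)" c]
    by (simp add: h_simps inner_simps inner_commute power2_eq_square algebra_simps)
  show "integrable rho (\<lambda>p. (c - (fst p \<bullet> u) *\<^sub>R g (fst p)) \<bullet> (H *v (c - (fst p \<bullet> u) *\<^sub>R g (fst p))))"
    unfolding e using form integral_fst_inner_scaled(1)[OF g, of u "H *v c"] by simp
  have "(\<integral>p. (c - (fst p \<bullet> u) *\<^sub>R g (fst p)) \<bullet> (H *v (c - (fst p \<bullet> u) *\<^sub>R g (fst p))) \<partial>rho)
    = c \<bullet> (H *v c) - 2 * ((H *v c) \<bullet> g (H *v u)) + (\<integral>p. (fst p \<bullet> u)\<^sup>2 * (g (fst p) \<bullet> (H *v g (fst p))) \<partial>rho)"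
    unfolding e using form integral_fst_inner_scaled[OF g, of u "H *v c"] by (simp add: prob_space)
  also have "c \<bullet> (H *v c) - 2 * ((H *v c) \<bullet> g (H *v u))
     = (c - g (H *v u)) \<bullet> (H *v (c - g (H *v u))) - g (H *v u) \<bullet> (H *v g (H *v u))"
    using H_sym[of c "g (H *v u)"] H_sym[of "g (H *v u)" c]
    by (simp add: h_simps inner_simps inner_commute)
  finally show "(\<integral>p. (c - (fst p \<bullet> u) *\<^sub>R g (fst p)) \<bullet> (H *v (c - (fst p \<bullet> u) *\<^sub>R g (fst p))) \<partial>rho)
        \<le> (c - g (H *v u)) \<bullet> (H *v (c - g (H *v u)))
          + (\<integral>p. (fst p \<bullet> u)\<^sup>2 * (g (fst p) \<bullet> (H *v g (fst p))) \<partial>rho)"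
    using H_nonneg[of "g (H *v u)"] by linarith
qed

text \<open>By linearity every later state is the unforced one minus (a, u) times the response to an
  impulse along a. Summed over time, the second moments of the responses are at most the mean of
  S(a) (a, u)^2, hence the share 2/3.\<close>

lemma
  shows integrable_cost_grad_step: "integrable rho (\<lambda>p. cost n (grad_step ((fst p \<bullet> fst \<theta>) *\<^sub>R fst p) \<theta>))"
    and integral_cost_grad_step_le: "(\<integral>p. cost n (grad_step ((fst p \<bullet> fst \<theta>) *\<^sub>R fst p) \<theta>) \<partial>rho)
      \<le> cost n (mean_step \<theta>) + 2/3 * (fst \<theta> \<bullet> (H *v fst \<theta>))"
proof -
  let ?c = "\<lambda>k. fst ((mean_step ^^ k) (fst \<theta> + snd \<theta>, snd \<theta>))"
  let ?g = "\<lambda>k a. fst ((mean_step ^^ k) (impulse a))"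
  let ?u = "fst \<theta>"
  let ?D = "\<lambda>k p. (?c k - (fst p \<bullet> ?u) *\<^sub>R ?g k (fst p)) \<bullet> (H *v (?c k - (fst p \<bullet> ?u) *\<^sub>R ?g k (fst p)))"
  note lin = linear_impulse_response
  have resp: "fst ((mean_step ^^ k) (grad_step v \<theta>)) = ?c k - ?g k v" for k v
    using linear_diff[OF linear_funpow_mean_step, of k "(fst \<theta> + snd \<theta>, snd \<theta>)" "impulse v"]
    by (simp add: grad_step_def impulse_def)
  have cost: "cost n (grad_step ((fst p \<bullet> ?u) *\<^sub>R fst p) \<theta>) = (\<Sum>k<n. ?D k p)" for p
    by (simp add: cost_def resp linear_scale[OF lin])
  have mean_step: "mean_step \<theta> = grad_step (H *v ?u) \<theta>"
    by (simp add: mean_step_def grad_step_def)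
  show "integrable rho (\<lambda>p. cost n (grad_step ((fst p \<bullet> ?u) *\<^sub>R fst p) \<theta>))"
    unfolding cost by (intro Bochner_Integration.integrable_sum integrable_perturbed_form lin)
  have "(\<integral>p. cost n (grad_step ((fst p \<bullet> ?u) *\<^sub>R fst p) \<theta>) \<partial>rho) = (\<Sum>k<n. \<integral>p. ?D k p \<partial>rho)"
    unfolding cost by (intro Bochner_Integration.integral_sum integrable_perturbed_form lin)
  also have "\<dots> \<le> (\<Sum>k<n. (?c k - ?g k (H *v ?u)) \<bullet> (H *v (?c k - ?g k (H *v ?u)))
          + (\<integral>p. (fst p \<bullet> ?u)\<^sup>2 * (?g k (fst p) \<bullet> (H *v ?g k (fst p))) \<partial>rho))"
    by (intro sum_mono integral_perturbed_form_le lin)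
  also have "\<dots> = cost n (mean_step \<theta>) + (\<integral>p. (\<Sum>k<n. (fst p \<bullet> ?u)\<^sup>2 * (?g k (fst p) \<bullet> (H *v ?g k (fst p)))) \<partial>rho)"
    unfolding mean_step cost_def resp sum.distrib
    by (subst Bochner_Integration.integral_sum) (auto intro: integrable_second_form lin)
  also have "(\<integral>p. (\<Sum>k<n. (fst p \<bullet> ?u)\<^sup>2 * (?g k (fst p) \<bullet> (H *v ?g k (fst p)))) \<partial>rho)
      \<le> (\<integral>p. potential (impulse (fst p)) * (fst p \<bullet> ?u)\<^sup>2 \<partial>rho)"
  proof (rule integral_mono)
    fix p
    have "cost n (impulse (fst p)) * (fst p \<bullet> ?u)\<^sup>2 \<le> potential (impulse (fst p)) * (fst p \<bullet> ?u)\<^sup>2"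
      by (intro mult_right_mono cost_le_potential) simp
    then show "(\<Sum>k<n. (fst p \<bullet> ?u)\<^sup>2 * (?g k (fst p) \<bullet> (H *v ?g k (fst p))))
      \<le> potential (impulse (fst p)) * (fst p \<bullet> ?u)\<^sup>2"
      by (simp add: cost_def sum_distrib_left mult.commute)
  qed (intro Bochner_Integration.integrable_sum integrable_second_form lin integrable_potential_second)+
  also have "\<dots> \<le> 2/3 * (?u \<bullet> (H *v ?u))"
    by (rule integral_potential_second_le)
  finally show "(\<integral>p. cost n (grad_step ((fst p \<bullet> ?u) *\<^sub>R fst p) \<theta>) \<partial>rho)
      \<le> cost n (mean_step \<theta>) + 2/3 * (?u \<bullet> (H *v ?u))"
    by simp
qed

text \<open>One recursion for all processes: \<open>e\<close> is \<open>noise\<close> for the full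
  and the variance process and 0 for the bias. In the coordinate p = (t + 1) (x - xs) the residual
  of the sample is scaled by t + 1, so the label noise carries the weight \<open>Suc t\<close> while
  the rest does not depend on time.\<close>

primrec trajectory :: "('d sample \<Rightarrow> real) \<Rightarrow> (real ^ 'd) \<times> (real ^ 'd) \<Rightarrow> (nat \<Rightarrow> 'd sample) \<Rightarrow> nat
    \<Rightarrow> (real ^ 'd) \<times> (real ^ 'd)" where
  "trajectory e \<theta> \<omega> 0 = \<theta>"
| "trajectory e \<theta> \<omega> (Suc t) = grad_step ((fst (\<omega> t) \<bullet> fst (trajectory e \<theta> \<omega> t) - real (Suc t) * e (\<omega> t)) *\<^sub>R fst (\<omega> t))
     (trajectory e \<theta> \<omega> t)"

lemma trajectory_cong: "(\<And>i. i < t \<Longrightarrow> \<omega> i = \<omega>' i) \<Longrightarrow> trajectory e \<theta> \<omega> t = trajectory e \<theta> \<omega>' t"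
  by (induction t) auto

lemma measurable_grad_step:
  assumes "g \<in> borel_measurable M" "f \<in> borel_measurable M"
  shows "(\<lambda>x. grad_step (g x) (f x)) \<in> borel_measurable M"
  unfolding grad_step_def
  by (intro borel_measurable_Pair borel_measurable_add borel_measurable_diff borel_measurable_scaleR
    borel_measurable_const measurable_fst_borel measurable_snd_borel assms)

lemma measurable_trajectory:
  assumes e: "e \<in> borel_measurable rho"
  shows "(\<lambda>\<omega>. trajectory e \<theta> \<omega> t) \<in> borel_measurable (samples rho)"
proof (induction t)
  case (Suc t)
  note [measurable] = e measurable_fst_borel[OF Suc]
  have "(\<lambda>\<omega>. (fst (\<omega> t) \<bullet> fst (trajectory e \<theta> \<omega> t) - real (Suc t) * e (\<omega> t)) *\<^sub>R fst (\<omega> t)) \<in> borel_measurable (samples rho)"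
    by measurable
  from measurable_grad_step[OF this Suc] show ?case by simp
qed simp

lemma measurable_form:
  assumes "f \<in> borel_measurable M"
  shows "(\<lambda>x. f x \<bullet> (H *v f x)) \<in> borel_measurable M"
proof -
  have "continuous_on UNIV (\<lambda>x. x \<bullet> (H *v x))"
    by (intro continuous_intros matrix_vector_mult_linear_continuous_on)
  from measurable_compose[OF assms borel_measurable_continuous_onI[OF this]] show ?thesis
    by simp
qed

lemma measurable_cost:
  assumes "f \<in> borel_measurable M"
  shows "(\<lambda>x. cost n (f x)) \<in> borel_measurable M"
proof -
  have "linear (\<lambda>\<theta>. fst ((mean_step ^^ k) \<theta>))" for k
    using linear_compose[OF linear_funpow_mean_step linear_fst] by (simp add: comp_def)
  then have "(\<lambda>x. fst ((mean_step ^^ k) (f x))) \<in> borel_measurable M" for k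
    by (intro measurable_compose[OF assms borel_measurable_continuous_onI] linear_continuous_on
      linear_conv_bounded_linear[THEN iffD1])
  then show ?thesis
    unfolding cost_def by (intro borel_measurable_sum measurable_form)
qed

abbreviation bias :: "real ^ 'd \<Rightarrow> (nat \<Rightarrow> 'd sample) \<Rightarrow> nat \<Rightarrow> (real ^ 'd) \<times> (real ^ 'd)" where
  "bias x \<equiv> trajectory (\<lambda>_. 0) (x, x)"

text \<open>The factor 3 is 1 / (1 - 2/3), where 2/3 is the share of the squared H-norm of p that the
  gradient fluctuations feed back at each step.\<close>

lemma bias_total_le_cost:
  "(\<integral>\<^sup>+\<omega>. ennreal (\<Sum>k<n. fst (bias x \<omega> (t + k)) \<bullet> (H *v fst (bias x \<omega> (t + k)))) \<partial>samples rho)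
    \<le> (\<integral>\<^sup>+\<omega>. ennreal (3 * cost n (bias x \<omega> t)) \<partial>samples rho)"
\<comment> \<open>Induction on the number of remaining steps, for every starting time: each step
  averages out only sample \<open>t\<close>, given the earlier ones. The integrals are nonnegative
  ones, since integrability of the states is not known beforehand.\<close>
proof (induction n arbitrary: t)
  case (Suc n)
  let ?b = "bias x"
  let ?w = "\<lambda>\<omega> t. fst (?b \<omega> t) \<bullet> (H *v fst (?b \<omega> t))"
  have mb: "(\<lambda>\<omega>. ?b \<omega> t) \<in> borel_measurable (samples rho)" for t
    by (rule measurable_trajectory) simp
  have mw: "(\<lambda>\<omega>. ?w \<omega> t) \<in> borel_measurable (samples rho)" for t
    by (intro measurable_form measurable_fst_borel mb)
  have w: "0 \<le> ?w \<omega> t" for \<omega> t by (rule H_nonneg)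
  let ?F = "\<lambda>\<omega> p. ennreal (3 * cost n (grad_step ((fst p \<bullet> fst (?b \<omega> t)) *\<^sub>R fst p) (?b \<omega> t)))"
  have mF: "(\<lambda>(\<omega>, p). ?F \<omega> p) \<in> borel_measurable (samples rho \<Otimes>\<^sub>M rho)"
  proof -
    have 1: "(\<lambda>y. ?b (fst y) t) \<in> borel_measurable (samples rho \<Otimes>\<^sub>M rho)"
      by (rule measurable_compose[OF measurable_fst mb])
    note [measurable] = measurable_fst_borel[OF 1]
    have "(\<lambda>y. (fst (snd y) \<bullet> fst (?b (fst y) t)) *\<^sub>R fst (snd y)) \<in> borel_measurable (samples rho \<Otimes>\<^sub>M rho)"
      by measurable
    from measurable_cost[OF measurable_grad_step[OF this 1], of n] show ?thesis
      unfolding case_prod_beta by measurable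
  qed
  have "(\<integral>\<^sup>+\<omega>. ennreal (\<Sum>k<Suc n. ?w \<omega> (t + k)) \<partial>samples rho)
    = (\<integral>\<^sup>+\<omega>. ennreal (?w \<omega> t) + ennreal (\<Sum>k<n. ?w \<omega> (Suc t + k)) \<partial>samples rho)"
  proof (rule nn_integral_cong)
    fix \<omega>
    have "0 \<le> (\<Sum>k<n. ?w \<omega> (Suc t + k))"
      by (intro sum_nonneg w)
    from ennreal_plus[OF w[of \<omega> t] this]
    show "ennreal (\<Sum>k<Suc n. ?w \<omega> (t + k)) = ennreal (?w \<omega> t) + ennreal (\<Sum>k<n. ?w \<omega> (Suc t + k))"
      by (simp add: sum.lessThan_Suc_shift del: sum.lessThan_Suc trajectory.simps)
  qed
  also have "\<dots> = (\<integral>\<^sup>+\<omega>. ennreal (?w \<omega> t) \<partial>samples rho) + (\<integral>\<^sup>+\<omega>. ennreal (\<Sum>k<n. ?w \<omega> (Suc t + k)) \<partial>samples rho)"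
    by (intro nn_integral_add measurable_compose[OF _ measurable_ennreal] borel_measurable_sum mw)
  also have "\<dots> \<le> (\<integral>\<^sup>+\<omega>. ennreal (?w \<omega> t) \<partial>samples rho) + (\<integral>\<^sup>+\<omega>. ennreal (3 * cost n (?b \<omega> (Suc t))) \<partial>samples rho)"
    by (intro add_left_mono Suc)
  also have "(\<integral>\<^sup>+\<omega>. ennreal (3 * cost n (?b \<omega> (Suc t))) \<partial>samples rho) = (\<integral>\<^sup>+\<omega>. ?F \<omega> (\<omega> t) \<partial>samples rho)"
    by simp
  also have "\<dots> = (\<integral>\<^sup>+\<omega>. \<integral>\<^sup>+p. ?F \<omega> p \<partial>rho \<partial>samples rho)"
  proof (rule nn_integral_stream_split[OF _ mF])
    fix \<omega> \<omega>' :: "nat \<Rightarrow> 'd sample" and s :: "'d sample"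
    assume "\<And>i. i < t \<Longrightarrow> \<omega> i = \<omega>' i"
    then have "?b \<omega> t = ?b \<omega>' t" by (rule trajectory_cong)
    then show "?F \<omega> s = ?F \<omega>' s" by simp
  qed
  also have "\<dots> \<le> (\<integral>\<^sup>+\<omega>. ennreal (3 * (cost n (mean_step (?b \<omega> t)) + 2/3 * ?w \<omega> t)) \<partial>samples rho)"
  proof (rule nn_integral_mono)
    fix \<omega>
    have "(\<integral>\<^sup>+p. ?F \<omega> p \<partial>rho) = ennreal (3 * (\<integral>p. cost n (grad_step ((fst p \<bullet> fst (?b \<omega> t)) *\<^sub>R fst p) (?b \<omega> t)) \<partial>rho))"
      using integrable_cost_grad_step[of n "?b \<omega> t"] by (subst nn_integral_eq_integral) (auto simp: cost_nonneg)
    then show "(\<integral>\<^sup>+p. ?F \<omega> p \<partial>rho) \<le> ennreal (3 * (cost n (mean_step (?b \<omega> t)) + 2/3 * ?w \<omega> t))"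
      using integral_cost_grad_step_le[of n "?b \<omega> t"] by (simp add: ennreal_leI)
  qed
  also have "(\<integral>\<^sup>+\<omega>. ennreal (?w \<omega> t) \<partial>samples rho)
      + (\<integral>\<^sup>+\<omega>. ennreal (3 * (cost n (mean_step (?b \<omega> t)) + 2/3 * ?w \<omega> t)) \<partial>samples rho)
    = (\<integral>\<^sup>+\<omega>. ennreal (?w \<omega> t) + ennreal (3 * (cost n (mean_step (?b \<omega> t)) + 2/3 * ?w \<omega> t)) \<partial>samples rho)"
  proof (rule nn_integral_add[symmetric])
    have "(\<lambda>\<omega>. mean_step (?b \<omega> t)) \<in> borel_measurable (samples rho)"
      by (intro measurable_compose[OF mb borel_measurable_continuous_onI] linear_continuous_on
        linear_conv_bounded_linear[THEN iffD1] linear_mean_step)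
    from measurable_cost[OF this, of n] mw[of t]
    show "(\<lambda>\<omega>. ennreal (3 * (cost n (mean_step (?b \<omega> t)) + 2/3 * ?w \<omega> t))) \<in> borel_measurable (samples rho)"
      by measurable
  qed (use mw in auto)
  \<comment> \<open>The factor reproduces itself: 1 + 3 * 2/3 = 3.\<close>
  also have "\<dots> = (\<integral>\<^sup>+\<omega>. ennreal (3 * cost (Suc n) (?b \<omega> t)) \<partial>samples rho)"
    by (intro nn_integral_cong) (simp add: cost_Suc w cost_nonneg flip: ennreal_plus)
  finally show ?case by simp
qed simp

lemma bias_total_le:
  "(\<integral>\<^sup>+\<omega>. ennreal (\<Sum>k<n. fst (bias x \<omega> k) \<bullet> (H *v fst (bias x \<omega> k))) \<partial>samples rho)
    \<le> ennreal (min (18/5 * real n / \<alpha>) (2 * (real n)\<^sup>2 / \<beta>) * (norm x)\<^sup>2)"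
proof -
  have "(\<integral>\<^sup>+\<omega>. ennreal (\<Sum>k<n. fst (bias x \<omega> k) \<bullet> (H *v fst (bias x \<omega> k))) \<partial>samples rho)
    \<le> ennreal (3 * cost n (x, x))"
    using bias_total_le_cost[where n=n and x=x and t=0] prob_space.emeasure_space_1[OF prob_space_stream] by simp
  also have "3 * cost n (x, x) \<le> min (18/5 * real n / \<alpha>) (2 * (real n)\<^sup>2 / \<beta>) * (norm x)\<^sup>2"
  proof -
    \<comment> \<open>The initial state is deterministic, so both cost bounds apply: 18/5 is 3 *
      6/5, and the 2 below is 3 divided by 3/2.\<close>
    have "3 * cost n (x, x) \<le> 18/5 * real n / \<alpha> * (norm x)\<^sup>2"
      using cost_le_energy[of n "(x, x)"] \<alpha>_pos by (simp add: energy_start field_simps)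
    moreover have "3 * cost n (x, x) \<le> 2 * (real n)\<^sup>2 / \<beta> * (norm x)\<^sup>2"
      using cost_start_damped[of n x] \<beta>_pos by (simp add: power_mult_distrib field_simps)
    ultimately show ?thesis by (simp add: min_mult_distrib_right)
  qed
  finally show ?thesis by (simp add: ennreal_leI)
qed

section \<open>The variance process\<close>

lemma integrable_noise_cubic:
  "integrable rho (\<lambda>p. (fst p \<bullet> u)\<^sup>2 * (noise p * (fst p \<bullet> v)))"
proof (rule Bochner_Integration.integrable_bound)
  show "integrable rho (\<lambda>p. (noise p)\<^sup>2 * (fst p \<bullet> u)\<^sup>2 + (fst p \<bullet> u)\<^sup>2 * (fst p \<bullet> v)\<^sup>2)"
    using integrable_noise_second integrable_fourth by simp
  show "AE p in rho. norm ((fst p \<bullet> u)\<^sup>2 * (noise p * (fst p \<bullet> v)))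
     \<le> norm ((noise p)\<^sup>2 * (fst p \<bullet> u)\<^sup>2 + (fst p \<bullet> u)\<^sup>2 * (fst p \<bullet> v)\<^sup>2)"
  proof (rule AE_I2)
    fix p
    have "(fst p \<bullet> u)\<^sup>2 * \<bar>noise p * (fst p \<bullet> v)\<bar> \<le> (fst p \<bullet> u)\<^sup>2 * ((noise p)\<^sup>2 + (fst p \<bullet> v)\<^sup>2)"
      by (intro mult_left_mono abs_mult_le_sum_squares) simp
    then show "norm ((fst p \<bullet> u)\<^sup>2 * (noise p * (fst p \<bullet> v)))
     \<le> norm ((noise p)\<^sup>2 * (fst p \<bullet> u)\<^sup>2 + (fst p \<bullet> u)\<^sup>2 * (fst p \<bullet> v)\<^sup>2)"
      by (simp add: abs_mult distrib_left mult_ac)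
  qed
qed measurable

text \<open>Label noise and features may be dependent, so this cross moment of additive and
  multiplicative noise need not vanish. It is linear in \<open>v\<close>, and \<open>v\<close> will
  be the current p of the variance process, which has mean 0; so it vanishes on average.\<close>

lemma noise_cubic_representation:
  obtains b where "\<And>v. (\<integral>p. (fst p \<bullet> u)\<^sup>2 * (noise p * (fst p \<bullet> v)) \<partial>rho) = b \<bullet> v"
proof
  let ?B = "\<lambda>v. \<integral>p. (fst p \<bullet> u)\<^sup>2 * (noise p * (fst p \<bullet> v)) \<partial>rho"
  have "linear ?B"
  proof (rule linearI)
    show "?B (x + y) = ?B x + ?B y" for x y
      using integrable_noise_cubic by (simp add: inner_add_right distrib_left)
    show "?B (c *\<^sub>R x) = c *\<^sub>R ?B x" for c x
      by (simp add: mult.left_commute)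
  qed
  then show "?B v = adjoint ?B 1 \<bullet> v" for v
    using adjoint_works[of ?B v 1] by (simp add: inner_commute)
qed

text \<open>X is a linear functional of the next state as a function of the fresh sample:
  \<open>y\<close> plus a centred fluctuation, whose variance is bounded by the second
  moment.\<close>

lemma
  fixes y k :: real and u v :: "real ^ 'd"
  defines "X \<equiv> \<lambda>p. y + u \<bullet> (H *v v) - (fst p \<bullet> u) * (fst p \<bullet> v - k * noise p)"
  shows integral_readout_sample: "(\<integral>p. X p \<partial>rho) = y"
    and integrable_readout_sample_sq: "integrable rho (\<lambda>p. (X p)\<^sup>2)"
    and integral_readout_sample_sq_le:
      "(\<integral>p. (X p)\<^sup>2 \<partial>rho) \<le> y\<^sup>2 + (\<integral>p. (fst p \<bullet> u)\<^sup>2 * (fst p \<bullet> v)\<^sup>2 \<partial>rho)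
        - 2 * k * (\<integral>p. (fst p \<bullet> u)\<^sup>2 * (noise p * (fst p \<bullet> v)) \<partial>rho)
        + k\<^sup>2 * (\<sigma>\<^sup>2 * (u \<bullet> (H *v u)))"
proof -
  let ?m = "u \<bullet> (H *v v)"
  have X: "X p = (y + ?m) - (fst p \<bullet> u) * (fst p \<bullet> v) + k * (noise p * (fst p \<bullet> u))" for p
    by (simp add: X_def algebra_simps)
  show "(\<integral>p. X p \<partial>rho) = y"
    unfolding X using integrable_second[of u v] integrable_noise_first[of u]
    by (simp add: prob_space integral_noise_first H_form)
  have sq: "(X p)\<^sup>2 = (y + ?m)\<^sup>2 - 2 * (y + ?m) * ((fst p \<bullet> u) * (fst p \<bullet> v))
      + 2 * (y + ?m) * k * (noise p * (fst p \<bullet> u))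
      + (fst p \<bullet> u)\<^sup>2 * (fst p \<bullet> v)\<^sup>2 - 2 * k * ((fst p \<bullet> u)\<^sup>2 * (noise p * (fst p \<bullet> v)))
      + k\<^sup>2 * ((noise p)\<^sup>2 * (fst p \<bullet> u)\<^sup>2)" for p
    unfolding X_def power2_eq_square by algebra
  note ints = integrable_second[of u v] integrable_noise_first[of u] integrable_fourth[of u v]
    integrable_noise_cubic[of u v] integrable_noise_second[of u]
  show "integrable rho (\<lambda>p. (X p)\<^sup>2)"
    unfolding sq using ints by (intro Bochner_Integration.integrable_add Bochner_Integration.integrable_diff integrable_mult_right integrable_const) auto
  have "(\<integral>p. (X p)\<^sup>2 \<partial>rho) = (y + ?m)\<^sup>2 - 2 * (y + ?m) * ?m
      + (\<integral>p. (fst p \<bullet> u)\<^sup>2 * (fst p \<bullet> v)\<^sup>2 \<partial>rho)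
      - 2 * k * (\<integral>p. (fst p \<bullet> u)\<^sup>2 * (noise p * (fst p \<bullet> v)) \<partial>rho)
      + k\<^sup>2 * (\<integral>p. (noise p)\<^sup>2 * (fst p \<bullet> u)\<^sup>2 \<partial>rho)"
    unfolding sq using ints by (simp add: prob_space integral_noise_first H_form)
  also have "(y + ?m)\<^sup>2 - 2 * (y + ?m) * ?m = y\<^sup>2 - ?m\<^sup>2"
    by (simp add: power2_eq_square algebra_simps)
  finally have "(\<integral>p. (X p)\<^sup>2 \<partial>rho) = y\<^sup>2 - ?m\<^sup>2
      + (\<integral>p. (fst p \<bullet> u)\<^sup>2 * (fst p \<bullet> v)\<^sup>2 \<partial>rho)
      - 2 * k * (\<integral>p. (fst p \<bullet> u)\<^sup>2 * (noise p * (fst p \<bullet> v)) \<partial>rho)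
      + k\<^sup>2 * (\<integral>p. (noise p)\<^sup>2 * (fst p \<bullet> u)\<^sup>2 \<partial>rho)" .
  moreover have "k\<^sup>2 * (\<integral>p. (noise p)\<^sup>2 * (fst p \<bullet> u)\<^sup>2 \<partial>rho) \<le> k\<^sup>2 * (\<sigma>\<^sup>2 * (u \<bullet> (H *v u)))"
    by (intro mult_left_mono integral_noise_second_le) simp
  moreover have "0 \<le> ?m\<^sup>2" by simp
  ultimately show "(\<integral>p. (X p)\<^sup>2 \<partial>rho) \<le> y\<^sup>2 + (\<integral>p. (fst p \<bullet> u)\<^sup>2 * (fst p \<bullet> v)\<^sup>2 \<partial>rho)
        - 2 * k * (\<integral>p. (fst p \<bullet> u)\<^sup>2 * (noise p * (fst p \<bullet> v)) \<partial>rho)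
        + k\<^sup>2 * (\<sigma>\<^sup>2 * (u \<bullet> (H *v u)))"
    by linarith
qed

section \<open>Linear readouts of the variance process\<close>

abbreviation var :: "(nat \<Rightarrow> 'd sample) \<Rightarrow> nat \<Rightarrow> (real ^ 'd) \<times> (real ^ 'd)" where
  "var \<equiv> trajectory noise (0, 0)"

text \<open>A family closed under going back one step: the last summand of the running sum becomes
  an impulse \<open>c\<close> added to \<open>q\<close>. It contains the functionals of p (c = 0, q
  an impulse) and those of the running sum (q = 0).\<close>

definition readout :: "(real ^ 'd) \<times> (real ^ 'd) \<Rightarrow> real ^ 'd \<Rightarrow> nat \<Rightarrow> (nat \<Rightarrow> 'd sample) \<Rightarrow> real" where
  "readout q c t \<omega> = reading q (var \<omega> t) + c \<bullet> (\<Sum>s<t. fst (var \<omega> s))"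

lemma readout_0: "readout q c 0 \<omega> = 0"
  by (simp add: readout_def reading_def)

lemma readout_Suc:
  "readout q c (Suc t) \<omega> = readout (mean_step q + impulse c) c t \<omega> + fst q \<bullet> (H *v fst (var \<omega> t))
    - (fst (\<omega> t) \<bullet> fst q) * (fst (\<omega> t) \<bullet> fst (var \<omega> t) - real (Suc t) * noise (\<omega> t))"
  by (simp add: readout_def reading_grad_step reading_add reading_impulse inner_simps inner_commute)

lemma readout_impulse: "readout (impulse u) 0 t \<omega> = u \<bullet> fst (var \<omega> t)"
  by (simp add: readout_def reading_impulse)

lemma readout_sum: "readout 0 c t \<omega> = c \<bullet> (\<Sum>s<t. fst (var \<omega> s))"
  by (simp add: readout_def reading_def)

lemma readout_cong: "(\<And>i. i < t \<Longrightarrow> \<omega> i = \<omega>' i) \<Longrightarrow> readout q c t \<omega> = readout q c t \<omega>'"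
proof -
  assume eq: "\<And>i. i < t \<Longrightarrow> \<omega> i = \<omega>' i"
  have "var \<omega> s = var \<omega>' s" if "s \<le> t" for s
    using eq that by (intro trajectory_cong) auto
  then show ?thesis by (simp add: readout_def)
qed

lemma measurable_var: "(\<lambda>\<omega>. var \<omega> t) \<in> borel_measurable (samples rho)"
  by (intro measurable_trajectory measurable_noise)

lemma measurable_readout: "readout q c t \<in> borel_measurable (samples rho)"
proof -
  note [measurable] = measurable_fst_borel[OF measurable_var] measurable_snd_borel[OF measurable_var]
  show ?thesis unfolding readout_def reading_def by measurable
qed

text \<open>A constant impulse c at every step is the unforced recursion shifted by hi c, so the energy of
  the shifted state does not increase.\<close>

definition drift_form :: "(real ^ 'd) \<times> (real ^ 'd) \<Rightarrow> real ^ 'd \<Rightarrow> real" where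
  "drift_form q c = 2 * (6/5 * energy (fst q - hi c, snd q) / \<alpha> + c \<bullet> hi c)"

lemma drift_form_mean_step: "drift_form (mean_step q + impulse c) c \<le> drift_form q c"
  using energy_mean_step[of "(fst q - hi c, snd q)"] \<alpha>_pos
  unfolding drift_form_def mean_step_impulse_shift by (simp add: divide_right_mono)

lemma h_form_le_drift_form: "fst q \<bullet> (H *v fst q) \<le> drift_form q c"
proof -
  let ?d = "fst q - hi c"
  have "fst q \<bullet> (H *v fst q) \<le> 2 * (?d \<bullet> (H *v ?d)) + 2 * (hi c \<bullet> (H *v hi c))"
    using h_form_young[of 1 ?d "hi c"] by simp
  moreover have "hi c \<bullet> (H *v hi c) = c \<bullet> hi c"
    by (simp add: H_hi inner_commute)
  moreover have "?d \<bullet> (H *v ?d) \<le> 6/5 * energy (?d, snd q) / \<alpha>"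
    using h_form_le_energy[of "(?d, snd q)"] \<alpha>_pos by (simp add: field_simps)
  ultimately show ?thesis by (simp add: drift_form_def)
qed

text \<open>The shifted state \<open>(- hi c, 0)\<close> has energy \<alpha> (c, hi c), and 22/5 = 2
  * (6/5 + 1).\<close>

lemma drift_form_0: "drift_form 0 c = 22/5 * (c \<bullet> hi c)"
  using \<alpha>_pos by (simp add: drift_form_def energy_def h_simps H_hi inner_commute)

text \<open>Induction on time for all \<open>q\<close> and \<open>c\<close> at once, because going
  back a step changes \<open>q\<close>. The constant 3 closes: the bound for c = 0, used for
  impulses along a fresh feature vector, makes the multiplicative noise contribute at most 3 * 2/3 =
  2 times \<sigma>^2 t^2, and the label noise adds \<sigma>^2 (t + 1)^2. The potential bounds
  readouts of the state, the drift form those of the running sum.\<close>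

lemma readout_moments:
  "integrable (samples rho) (\<lambda>\<omega>. (readout q c t \<omega>)\<^sup>2)
   \<and> (\<integral>\<omega>. readout q c t \<omega> \<partial>samples rho) = 0
   \<and> (\<integral>\<omega>. (readout q 0 t \<omega>)\<^sup>2 \<partial>samples rho) \<le> 3 * \<sigma>\<^sup>2 * (real t)\<^sup>2 * potential q
   \<and> (\<integral>\<omega>. (readout q c t \<omega>)\<^sup>2 \<partial>samples rho) \<le> (\<Sum>s<t. 3 * \<sigma>\<^sup>2 * (real (Suc s))\<^sup>2) * drift_form q c"
proof (induction t arbitrary: q c)
  case 0
  then show ?case by (simp add: readout_0)
next
  case (Suc t)
  interpret S: prob_space "samples rho" by (rule prob_space_stream)
  interpret SM: pair_sigma_finite "samples rho" rho
    by (intro pair_sigma_finite.intro prob_space_imp_sigma_finite prob_space_stream prob_space_axioms)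
  let ?p = "\<lambda>\<omega>. fst (var \<omega> t)"
  have IH_int: "integrable (samples rho) (\<lambda>\<omega>. (readout q c t \<omega>)\<^sup>2)" for q c
    using Suc by blast
  have IH_mean: "(\<integral>\<omega>. readout q c t \<omega> \<partial>samples rho) = 0" for q c
    using Suc by blast
  have IH1: "(\<integral>\<omega>. (readout q 0 t \<omega>)\<^sup>2 \<partial>samples rho) \<le> 3 * \<sigma>\<^sup>2 * (real t)\<^sup>2 * potential q" for q
    using Suc by blast
  have IH2: "(\<integral>\<omega>. (readout q c t \<omega>)\<^sup>2 \<partial>samples rho) \<le> (\<Sum>s<t. 3 * \<sigma>\<^sup>2 * (real (Suc s))\<^sup>2) * drift_form q c" for q c
    using Suc by blast
  have int1: "integrable (samples rho) (readout q c t)" for q c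
    by (rule S.square_integrable_imp_integrable[OF measurable_readout IH_int])
  have mp: "?p \<in> borel_measurable (samples rho)"
    by (intro measurable_fst_borel measurable_var)
  define A where "A u v = (\<integral>p. (fst p \<bullet> u)\<^sup>2 * (fst p \<bullet> v)\<^sup>2 \<partial>rho)" for u v :: "real ^ 'd"

  \<comment> \<open>Exchange the integrals: for a fixed feature vector a, the second moment of (a,
    p) over the stream is bounded by S(a) through the induction hypothesis; then
    \<open>integral_potential_second_le\<close> averages over a.\<close>
  have A: "integrable (samples rho) (\<lambda>\<omega>. A u (?p \<omega>)) \<and>
      (\<integral>\<omega>. A u (?p \<omega>) \<partial>samples rho) \<le> 2 * \<sigma>\<^sup>2 * (real t)\<^sup>2 * (u \<bullet> (H *v u))" for u
  proof -
    have A_nonneg: "0 \<le> A u v" for v by (simp add: A_def)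
    let ?K = "3 * \<sigma>\<^sup>2 * (real t)\<^sup>2"
    have mF: "(\<lambda>(\<omega>, p). ennreal ((fst p \<bullet> u)\<^sup>2 * (fst p \<bullet> ?p \<omega>)\<^sup>2)) \<in> borel_measurable (samples rho \<Otimes>\<^sub>M rho)"
    proof -
      note [measurable] = measurable_compose[OF measurable_fst mp]
      show ?thesis unfolding case_prod_beta by measurable
    qed
    have A_nn: "ennreal (A u v) = (\<integral>\<^sup>+p. ennreal ((fst p \<bullet> u)\<^sup>2 * (fst p \<bullet> v)\<^sup>2) \<partial>rho)" for v
      unfolding A_def using integrable_fourth by (subst nn_integral_eq_integral) auto
    have mA: "(\<lambda>\<omega>. A u (?p \<omega>)) \<in> borel_measurable (samples rho)"
    proof -
      have "(\<lambda>(\<omega>, p). (fst p \<bullet> u)\<^sup>2 * (fst p \<bullet> ?p \<omega>)\<^sup>2) \<in> borel_measurable (samples rho \<Otimes>\<^sub>M rho)"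
      proof -
        note [measurable] = measurable_compose[OF measurable_fst mp]
        show ?thesis unfolding case_prod_beta by measurable
      qed
      then show ?thesis
        unfolding A_def by (rule borel_measurable_lebesgue_integral)
    qed
    have "(\<integral>\<^sup>+\<omega>. ennreal (A u (?p \<omega>)) \<partial>samples rho)
      = (\<integral>\<^sup>+p. \<integral>\<^sup>+\<omega>. ennreal ((fst p \<bullet> u)\<^sup>2 * (fst p \<bullet> ?p \<omega>)\<^sup>2) \<partial>samples rho \<partial>rho)"
      unfolding A_nn using SM.Fubini[OF mF] by simp
    also have "\<dots> \<le> (\<integral>\<^sup>+p. ennreal (?K * (potential (impulse (fst p)) * (fst p \<bullet> u)\<^sup>2)) \<partial>rho)"
    proof (rule nn_integral_mono)
      fix p :: "'d sample"
      have "(\<integral>\<^sup>+\<omega>. ennreal ((fst p \<bullet> u)\<^sup>2 * (fst p \<bullet> ?p \<omega>)\<^sup>2) \<partial>samples rho)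
         = (\<integral>\<^sup>+\<omega>. ennreal ((fst p \<bullet> u)\<^sup>2 * (readout (impulse (fst p)) 0 t \<omega>)\<^sup>2) \<partial>samples rho)"
        by (simp add: readout_impulse)
      also have "\<dots> = ennreal ((fst p \<bullet> u)\<^sup>2 * (\<integral>\<omega>. (readout (impulse (fst p)) 0 t \<omega>)\<^sup>2 \<partial>samples rho))"
        using IH_int by (subst nn_integral_eq_integral) auto
      also have "\<dots> \<le> ennreal ((fst p \<bullet> u)\<^sup>2 * (?K * potential (impulse (fst p))))"
        by (intro ennreal_leI mult_left_mono IH1) auto
      finally show "(\<integral>\<^sup>+\<omega>. ennreal ((fst p \<bullet> u)\<^sup>2 * (fst p \<bullet> ?p \<omega>)\<^sup>2) \<partial>samples rho)
        \<le> ennreal (?K * (potential (impulse (fst p)) * (fst p \<bullet> u)\<^sup>2))"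
        by (simp add: mult_ac)
    qed
    also have "\<dots> = ennreal (?K * (\<integral>p. potential (impulse (fst p)) * (fst p \<bullet> u)\<^sup>2 \<partial>rho))"
      using integrable_potential_second potential_nonneg by (subst nn_integral_eq_integral) auto
    also have "\<dots> \<le> ennreal (?K * (2/3 * (u \<bullet> (H *v u))))"
      by (intro ennreal_leI mult_left_mono integral_potential_second_le) auto
    finally have le: "(\<integral>\<^sup>+\<omega>. ennreal (A u (?p \<omega>)) \<partial>samples rho) \<le> ennreal (?K * (2/3 * (u \<bullet> (H *v u))))" .
    have int: "integrable (samples rho) (\<lambda>\<omega>. A u (?p \<omega>))"
      using le mA A_nonneg by (intro integrableI_nonneg) (auto simp: le_less_trans[OF _ ennreal_less_top])
    moreover have "(\<integral>\<omega>. A u (?p \<omega>) \<partial>samples rho) \<le> ?K * (2/3 * (u \<bullet> (H *v u)))"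
      using le H_nonneg[of u] A_nonneg by (subst (asm) nn_integral_eq_integral[OF int]) auto
    ultimately show ?thesis by (simp add: mult_ac)
  qed

  \<comment> \<open>Going back one step, conditionally on the first \<open>t\<close> samples, costs
    one fluctuation term: two parts multiplicative noise, one part label noise.\<close>
  have key: "integrable (samples rho) (\<lambda>\<omega>. (readout q c (Suc t) \<omega>)\<^sup>2)
    \<and> (\<integral>\<omega>. readout q c (Suc t) \<omega> \<partial>samples rho) = 0
    \<and> (\<integral>\<omega>. (readout q c (Suc t) \<omega>)\<^sup>2 \<partial>samples rho)
        \<le> (\<integral>\<omega>. (readout (mean_step q + impulse c) c t \<omega>)\<^sup>2 \<partial>samples rho)
          + 3 * \<sigma>\<^sup>2 * (real (Suc t))\<^sup>2 * (fst q \<bullet> (H *v fst q))" for q c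
  proof -
    let ?u = "fst q" and ?k = "real (Suc t)" and ?y = "readout (mean_step q + impulse c) c t"
    let ?X = "\<lambda>\<omega> p. ?y \<omega> + ?u \<bullet> (H *v ?p \<omega>) - (fst p \<bullet> ?u) * (fst p \<bullet> ?p \<omega> - ?k * noise p)"
    obtain b where b: "\<And>v. (\<integral>p. (fst p \<bullet> ?u)\<^sup>2 * (noise p * (fst p \<bullet> v)) \<partial>rho) = b \<bullet> v"
      using noise_cubic_representation[of ?u] by blast
    have dep: "?X \<omega> s = ?X \<omega>' s" if "\<And>i. i < t \<Longrightarrow> \<omega> i = \<omega>' i" for \<omega> \<omega>' s
      using readout_cong[OF that] trajectory_cong[OF that] by simp
    have mX: "(\<lambda>(\<omega>, p). ?X \<omega> p) \<in> borel_measurable (samples rho \<Otimes>\<^sub>M rho)"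
    proof -
      have "(\<lambda>\<omega>. ?u \<bullet> (H *v ?p \<omega>)) = (\<lambda>\<omega>. (H *v ?u) \<bullet> ?p \<omega>)"
        by (simp add: H_sym)
      then have "(\<lambda>\<omega>. ?u \<bullet> (H *v ?p \<omega>)) \<in> borel_measurable (samples rho)"
        using mp by simp
      note [measurable] = measurable_compose[OF measurable_fst mp] measurable_compose[OF measurable_fst this]
        measurable_compose[OF measurable_fst measurable_readout]
      show ?thesis unfolding case_prod_beta by measurable
    qed
    have mX2: "(\<lambda>(\<omega>, p). ennreal ((?X \<omega> p)\<^sup>2)) \<in> borel_measurable (samples rho \<Otimes>\<^sub>M rho)"
      using mX unfolding case_prod_beta by measurable
    let ?\<phi> = "\<lambda>\<omega>. (?y \<omega>)\<^sup>2 + A ?u (?p \<omega>) - 2 * ?k * (b \<bullet> ?p \<omega>) + ?k\<^sup>2 * (\<sigma>\<^sup>2 * (?u \<bullet> (H *v ?u)))"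
    have \<phi>: "(\<integral>p. (?X \<omega> p)\<^sup>2 \<partial>rho) \<le> ?\<phi> \<omega>" for \<omega>
      using integral_readout_sample_sq_le[of "?y \<omega>" ?u "?p \<omega>" ?k] unfolding b A_def[symmetric] .
    have \<phi>_nonneg: "0 \<le> ?\<phi> \<omega>" for \<omega>
      by (rule order_trans[OF _ \<phi>]) simp
    have bp: "integrable (samples rho) (\<lambda>\<omega>. b \<bullet> ?p \<omega>)" "(\<integral>\<omega>. b \<bullet> ?p \<omega> \<partial>samples rho) = 0"
      using int1[of "impulse b" 0] IH_mean[of "impulse b" 0] by (simp_all add: readout_impulse[abs_def])
    have int_\<phi>: "integrable (samples rho) ?\<phi>"
      using IH_int A bp by simp
    have "(\<integral>\<omega>. ?\<phi> \<omega> \<partial>samples rho) = (\<integral>\<omega>. (?y \<omega>)\<^sup>2 \<partial>samples rho)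
        + (\<integral>\<omega>. A ?u (?p \<omega>) \<partial>samples rho) + ?k\<^sup>2 * (\<sigma>\<^sup>2 * (?u \<bullet> (H *v ?u)))"
      using IH_int A bp by (simp add: S.prob_space)
    also have "\<dots> \<le> (\<integral>\<omega>. (?y \<omega>)\<^sup>2 \<partial>samples rho)
       + 2 * \<sigma>\<^sup>2 * (real t)\<^sup>2 * (?u \<bullet> (H *v ?u)) + ?k\<^sup>2 * (\<sigma>\<^sup>2 * (?u \<bullet> (H *v ?u)))"
      using A[of ?u] by simp
    also have "\<dots> \<le> (\<integral>\<omega>. (?y \<omega>)\<^sup>2 \<partial>samples rho)
       + 2 * \<sigma>\<^sup>2 * ?k\<^sup>2 * (?u \<bullet> (H *v ?u)) + ?k\<^sup>2 * (\<sigma>\<^sup>2 * (?u \<bullet> (H *v ?u)))"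
      using H_nonneg[of ?u]
      by (intro add_mono mult_right_mono mult_left_mono power_mono) auto
    finally have \<phi>_le: "(\<integral>\<omega>. ?\<phi> \<omega> \<partial>samples rho) \<le> (\<integral>\<omega>. (?y \<omega>)\<^sup>2 \<partial>samples rho)
          + 3 * \<sigma>\<^sup>2 * ?k\<^sup>2 * (?u \<bullet> (H *v ?u))"
      by (simp add: algebra_simps)
    have "(\<integral>\<^sup>+\<omega>. ennreal ((readout q c (Suc t) \<omega>)\<^sup>2) \<partial>samples rho)
       = (\<integral>\<^sup>+\<omega>. ennreal ((?X \<omega> (\<omega> t))\<^sup>2) \<partial>samples rho)"
      by (simp only: readout_Suc)
    also have "\<dots> = (\<integral>\<^sup>+\<omega>. \<integral>\<^sup>+p. ennreal ((?X \<omega> p)\<^sup>2) \<partial>rho \<partial>samples rho)"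
      by (rule nn_integral_stream_split[OF _ mX2], rule arg_cong[where f="\<lambda>x. ennreal (x\<^sup>2)"], rule dep, blast)
    also have "\<dots> \<le> (\<integral>\<^sup>+\<omega>. ennreal (?\<phi> \<omega>) \<partial>samples rho)"
    proof (rule nn_integral_mono)
      fix \<omega>
      have "(\<integral>\<^sup>+p. ennreal ((?X \<omega> p)\<^sup>2) \<partial>rho) = ennreal (\<integral>p. (?X \<omega> p)\<^sup>2 \<partial>rho)"
        by (rule nn_integral_eq_integral[OF integrable_readout_sample_sq]) simp
      then show "(\<integral>\<^sup>+p. ennreal ((?X \<omega> p)\<^sup>2) \<partial>rho) \<le> ennreal (?\<phi> \<omega>)"
        using ennreal_leI[OF \<phi>] by simp
    qed
    also have "\<dots> = ennreal (\<integral>\<omega>. ?\<phi> \<omega> \<partial>samples rho)"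
      using \<phi>_nonneg by (intro nn_integral_eq_integral int_\<phi>) auto
    finally have le: "(\<integral>\<^sup>+\<omega>. ennreal ((readout q c (Suc t) \<omega>)\<^sup>2) \<partial>samples rho)
      \<le> ennreal (\<integral>\<omega>. ?\<phi> \<omega> \<partial>samples rho)" .
    have int: "integrable (samples rho) (\<lambda>\<omega>. (readout q c (Suc t) \<omega>)\<^sup>2)"
      using le measurable_readout
      by (intro integrableI_nonneg) (auto simp: le_less_trans[OF _ ennreal_less_top])
    have "(\<integral>\<omega>. (readout q c (Suc t) \<omega>)\<^sup>2 \<partial>samples rho) \<le> (\<integral>\<omega>. ?\<phi> \<omega> \<partial>samples rho)"
      using le \<phi>_nonneg by (subst (asm) nn_integral_eq_integral[OF int]) (auto simp: ennreal_le_iff integral_nonneg)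
    moreover have "(\<integral>\<omega>. readout q c (Suc t) \<omega> \<partial>samples rho) = 0"
    proof -
      have "integrable (samples rho) (readout q c (Suc t))"
        by (rule S.square_integrable_imp_integrable[OF measurable_readout int])
      then have i: "integrable (samples rho) (\<lambda>\<omega>. ?X \<omega> (\<omega> t))"
        by (simp only: readout_Suc[abs_def])
      have "(\<integral>\<omega>. readout q c (Suc t) \<omega> \<partial>samples rho) = (\<integral>\<omega>. ?X \<omega> (\<omega> t) \<partial>samples rho)"
        by (simp only: readout_Suc)
      also have "\<dots> = (\<integral>\<omega>. \<integral>p. ?X \<omega> p \<partial>rho \<partial>samples rho)"
        by (rule integral_stream_split[OF _ mX i], rule dep, blast)
      also have "\<dots> = (\<integral>\<omega>. ?y \<omega> \<partial>samples rho)"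
        by (simp only: integral_readout_sample)
      finally show ?thesis by (simp only: IH_mean)
    qed
    ultimately show ?thesis
      using int \<phi>_le by simp
  qed

  have "(\<integral>\<omega>. (readout q 0 (Suc t) \<omega>)\<^sup>2 \<partial>samples rho) \<le> 3 * \<sigma>\<^sup>2 * (real (Suc t))\<^sup>2 * potential q"
  proof -
    have "mean_step q + impulse 0 = mean_step q" by (simp add: impulse_def zero_prod_def[symmetric])
    then have "(\<integral>\<omega>. (readout q 0 (Suc t) \<omega>)\<^sup>2 \<partial>samples rho)
       \<le> 3 * \<sigma>\<^sup>2 * (real t)\<^sup>2 * potential (mean_step q) + 3 * \<sigma>\<^sup>2 * (real (Suc t))\<^sup>2 * (fst q \<bullet> (H *v fst q))"
      using key[of q 0] IH1[of "mean_step q"] by simp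
    \<comment> \<open>Raising t^2 to (t + 1)^2 gives both terms the same weight, so that the
      decrease of the potential pays for the new noise exactly.\<close>
    also have "\<dots> \<le> 3 * \<sigma>\<^sup>2 * (real (Suc t))\<^sup>2 * potential (mean_step q) + 3 * \<sigma>\<^sup>2 * (real (Suc t))\<^sup>2 * (fst q \<bullet> (H *v fst q))"
      using potential_nonneg by (intro add_mono mult_right_mono mult_left_mono power_mono) auto
    also have "\<dots> = 3 * \<sigma>\<^sup>2 * (real (Suc t))\<^sup>2 * (potential (mean_step q) + fst q \<bullet> (H *v fst q))"
      by (simp only: distrib_left)
    also have "\<dots> \<le> 3 * \<sigma>\<^sup>2 * (real (Suc t))\<^sup>2 * potential q"
      by (intro mult_left_mono potential_mean_step) auto
    finally show ?thesis .
  qed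
  \<comment> \<open>The drift form need not decrease strictly, so each time contributes its own
    weight; this is the source of the sum of squares.\<close>
  moreover have "(\<integral>\<omega>. (readout q c (Suc t) \<omega>)\<^sup>2 \<partial>samples rho)
      \<le> (\<Sum>s<Suc t. 3 * \<sigma>\<^sup>2 * (real (Suc s))\<^sup>2) * drift_form q c"
  proof -
    have "(\<integral>\<omega>. (readout (mean_step q + impulse c) c t \<omega>)\<^sup>2 \<partial>samples rho)
      \<le> (\<Sum>s<t. 3 * \<sigma>\<^sup>2 * (real (Suc s))\<^sup>2) * drift_form q c"
      by (rule order_trans[OF IH2]) (intro mult_left_mono drift_form_mean_step sum_nonneg, simp)
    moreover have "3 * \<sigma>\<^sup>2 * (real (Suc t))\<^sup>2 * (fst q \<bullet> (H *v fst q)) \<le> 3 * \<sigma>\<^sup>2 * (real (Suc t))\<^sup>2 * drift_form q c"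
      by (intro mult_left_mono h_form_le_drift_form) auto
    ultimately show ?thesis
      using key[of q c] by (simp add: distrib_right)
  qed
  ultimately show ?case
    using key[of q c] by blast
qed

lemma sum_squares_le: "(\<Sum>s<t. (real (Suc s))\<^sup>2) \<le> real t * real (t + 1) * real (2 * t + 1) / 6"
  by (induction t) (auto simp: power2_eq_square field_simps)

text \<open>Writing H as the second moment of an independent feature vector a reduces the form to
  readouts of the running sum along a, with drift form 22/5 (a, hi a), whose mean is 22/5 times the
  dimension. The constant is 3 * 22/5 / 6 = 11/5.\<close>

lemma var_total_le:
  "(\<integral>\<^sup>+\<omega>. ennreal ((\<Sum>s<t. fst (var \<omega> s)) \<bullet> (H *v (\<Sum>s<t. fst (var \<omega> s)))) \<partial>samples rho)
    \<le> ennreal (11/5 * \<sigma>\<^sup>2 * (real t * real (t + 1) * real (2 * t + 1)) * real CARD('d))"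
proof -
  interpret SM: pair_sigma_finite "samples rho" rho
    by (intro pair_sigma_finite.intro prob_space_imp_sigma_finite prob_space_stream prob_space_axioms)
  let ?P = "\<lambda>\<omega>. \<Sum>s<t. fst (var \<omega> s)"
  let ?\<Gamma> = "\<Sum>s<t. 3 * \<sigma>\<^sup>2 * (real (Suc s))\<^sup>2"
  have mP: "?P \<in> borel_measurable (samples rho)"
    by (intro borel_measurable_sum measurable_fst_borel measurable_var)
  have mF: "(\<lambda>(\<omega>, p). ennreal ((fst p \<bullet> ?P \<omega>)\<^sup>2)) \<in> borel_measurable (samples rho \<Otimes>\<^sub>M rho)"
  proof -
    note [measurable] = measurable_compose[OF measurable_fst mP]
    show ?thesis unfolding case_prod_beta by measurable
  qed
  have "(\<integral>\<^sup>+\<omega>. ennreal (?P \<omega> \<bullet> (H *v ?P \<omega>)) \<partial>samples rho)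
     = (\<integral>\<^sup>+\<omega>. \<integral>\<^sup>+p. ennreal ((fst p \<bullet> ?P \<omega>)\<^sup>2) \<partial>rho \<partial>samples rho)"
    unfolding H_form power2_eq_square
    by (intro nn_integral_cong nn_integral_eq_integral[symmetric] integrable_second) auto
  also have "\<dots> = (\<integral>\<^sup>+p. \<integral>\<^sup>+\<omega>. ennreal ((fst p \<bullet> ?P \<omega>)\<^sup>2) \<partial>samples rho \<partial>rho)"
    using SM.Fubini[OF mF] by simp
  also have "\<dots> \<le> (\<integral>\<^sup>+p. ennreal (?\<Gamma> * (22/5) * (fst p \<bullet> hi (fst p))) \<partial>rho)"
  proof (rule nn_integral_mono)
    fix p :: "'d sample"
    have "(\<integral>\<^sup>+\<omega>. ennreal ((fst p \<bullet> ?P \<omega>)\<^sup>2) \<partial>samples rho)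
      = (\<integral>\<^sup>+\<omega>. ennreal ((readout 0 (fst p) t \<omega>)\<^sup>2) \<partial>samples rho)"
      by (simp add: readout_sum)
    also have "\<dots> = ennreal (\<integral>\<omega>. (readout 0 (fst p) t \<omega>)\<^sup>2 \<partial>samples rho)"
      using readout_moments by (intro nn_integral_eq_integral) auto
    also have "\<dots> \<le> ennreal (?\<Gamma> * drift_form 0 (fst p))"
      using readout_moments by (intro ennreal_leI) blast
    finally show "(\<integral>\<^sup>+\<omega>. ennreal ((fst p \<bullet> ?P \<omega>)\<^sup>2) \<partial>samples rho)
      \<le> ennreal (?\<Gamma> * (22/5) * (fst p \<bullet> hi (fst p)))"
      by (simp add: drift_form_0 mult.assoc)
  qed
  also have "\<dots> = ennreal (?\<Gamma> * (22/5) * real CARD('d))"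
  proof -
    have "0 \<le> ?\<Gamma>" by (intro sum_nonneg) simp
    then show ?thesis
      using integral_hi_form hi_nonneg by (subst nn_integral_eq_integral) auto
  qed
  also have "\<dots> \<le> ennreal (11/5 * \<sigma>\<^sup>2 * (real t * real (t + 1) * real (2 * t + 1)) * real CARD('d))"
  proof (rule ennreal_leI)
    have "?\<Gamma> = 3 * \<sigma>\<^sup>2 * (\<Sum>s<t. (real (Suc s))\<^sup>2)"
      by (simp only: sum_distrib_left)
    also have "\<dots> \<le> 3 * \<sigma>\<^sup>2 * (real t * real (t + 1) * real (2 * t + 1) / 6)"
      by (intro mult_left_mono sum_squares_le) auto
    finally have "?\<Gamma> * (22/5 * real CARD('d))
      \<le> 3 * \<sigma>\<^sup>2 * (real t * real (t + 1) * real (2 * t + 1) / 6) * (22/5 * real CARD('d))"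
      by (intro mult_right_mono) auto
    also have "\<dots> = 11/5 * \<sigma>\<^sup>2 * (real t * real (t + 1) * real (2 * t + 1)) * real CARD('d)"
      by simp
    finally show "?\<Gamma> * (22/5) * real CARD('d) \<le> 11/5 * \<sigma>\<^sup>2 * (real t * real (t + 1) * real (2 * t + 1)) * real CARD('d)"
      by (simp only: mult.assoc)
  qed
  finally show ?thesis .
qed

section \<open>The averaged iterate\<close>

text \<open>The weights t + 2 and t + 1 of the update are what removes the time from the recursion:
  (t + 2) (x' - xs) = (t + 1) (y' - xs) + (z' - xs).\<close>

lemma acsgd_eq_trajectory:
  "trajectory noise (x0 - xs, x0 - xs) \<omega> t
    = (real (t + 1) *\<^sub>R (fst (acsgd \<alpha> \<beta> x0 \<omega> t) - xs), snd (acsgd \<alpha> \<beta> x0 \<omega> t) - xs)"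
proof (induction t)
  case (Suc t)
  define x z where "x = fst (acsgd \<alpha> \<beta> x0 \<omega> t)" and "z = snd (acsgd \<alpha> \<beta> x0 \<omega> t)"
  define a b where "a = fst (\<omega> t)" and "b = snd (\<omega> t)"
  define g where "g = (a \<bullet> x - b) *\<^sub>R a"
  have IH: "trajectory noise (x0 - xs, x0 - xs) \<omega> t = (real (t + 1) *\<^sub>R (x - xs), z - xs)"
    using Suc by (simp add: x_def z_def)
  have "a \<bullet> (real (t + 1) *\<^sub>R (x - xs)) - real (Suc t) * noise (\<omega> t) = real (t + 1) * (a \<bullet> x - b)"
    by (simp add: noise_def a_def b_def inner_simps inner_commute algebra_simps)
  then have G: "(a \<bullet> (real (t + 1) *\<^sub>R (x - xs)) - real (Suc t) * noise (\<omega> t)) *\<^sub>R a = real (t + 1) *\<^sub>R g"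
    by (simp add: g_def)
  have trajectory: "trajectory noise (x0 - xs, x0 - xs) \<omega> (Suc t)
    = grad_step (real (t + 1) *\<^sub>R g) (real (t + 1) *\<^sub>R (x - xs), z - xs)"
    using G by (simp only: trajectory.simps IH fst_conv a_def)
  have z': "snd (acsgd \<alpha> \<beta> x0 \<omega> (Suc t)) = z - (\<alpha> * real (t + 1)) *\<^sub>R g"
    by (simp add: Let_def x_def z_def a_def b_def g_def)
  have "fst (acsgd \<alpha> \<beta> x0 \<omega> (Suc t))
    = (1 / real (t + 2)) *\<^sub>R (real (t + 1) *\<^sub>R (x - \<beta> *\<^sub>R g) + (z - (\<alpha> * real (t + 1)) *\<^sub>R g))"
    by (simp add: Let_def x_def z_def a_def b_def g_def)
  then have "real (t + 2) *\<^sub>R fst (acsgd \<alpha> \<beta> x0 \<omega> (Suc t))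
    = real (t + 1) *\<^sub>R (x - \<beta> *\<^sub>R g) + (z - (\<alpha> * real (t + 1)) *\<^sub>R g)"
    by simp
  then have x': "real (Suc t + 1) *\<^sub>R (fst (acsgd \<alpha> \<beta> x0 \<omega> (Suc t)) - xs)
    = real (t + 1) *\<^sub>R (x - \<beta> *\<^sub>R g) + (z - (\<alpha> * real (t + 1)) *\<^sub>R g) - real (t + 2) *\<^sub>R xs"
    by (simp add: scaleR_diff_right)
  have xs: "real (t + 2) *\<^sub>R xs = real (t + 1) *\<^sub>R xs + xs"
    using scaleR_add_left[of "real (t + 1)" 1 xs] by (simp add: add.commute)
  show ?case
    unfolding trajectory x' z' xs by (simp add: grad_step_def algebra_simps del: of_nat_add)
qed simp

lemma trajectory_decompose: "trajectory noise (x, x) \<omega> t = bias x \<omega> t + var \<omega> t"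
proof (induction t)
  case (Suc t)
  show ?case
    by (simp add: Suc grad_step_def inner_simps algebra_simps)
qed simp

text \<open>Jensen's inequality for the squared H-norm, by symmetrising the double sum.\<close>

lemma h_form_sum_le:
  "(\<Sum>k<n. f k) \<bullet> (H *v (\<Sum>k<n. f k)) \<le> real n * (\<Sum>k<n. f k \<bullet> (H *v f k))"
proof -
  have "(\<Sum>k<n. f k) \<bullet> (H *v (\<Sum>k<n. f k)) = (\<Sum>i<n. \<Sum>j<n. f i \<bullet> (H *v f j))"
    unfolding linear_sum[OF linear_h] inner_sum_right inner_sum_left by (rule sum.swap)
  also have "\<dots> \<le> (\<Sum>i<n. \<Sum>j<n. 1/2 * (f i \<bullet> (H *v f i)) + 1/2 * (f j \<bullet> (H *v f j)))"
  proof (intro sum_mono)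
    fix i j
    show "f i \<bullet> (H *v f j) \<le> 1/2 * (f i \<bullet> (H *v f i)) + 1/2 * (f j \<bullet> (H *v f j))"
      using H_nonneg[of "f i - f j"] H_sym[of "f i" "f j"]
      by (simp add: h_simps inner_simps inner_commute)
  qed
  also have "\<dots> = real n * (\<Sum>k<n. f k \<bullet> (H *v f k))"
    by (simp add: sum.distrib flip: sum_distrib_left sum_divide_distrib)
  finally show ?thesis .
qed

text \<open>The averaging weights t + 1 turn the numerator into the plain sum of the p's, which
  splits into bias and variance.\<close>

lemma acsgd_avg_eq:
  "acsgd_avg \<alpha> \<beta> x0 \<omega> T - xs = (2 / (real (T + 1) * real (T + 2))) *\<^sub>R
     ((\<Sum>k<Suc T. fst (bias (x0 - xs) \<omega> k)) + (\<Sum>k<Suc T. fst (var \<omega> k)))"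
proof -
  let ?W = "\<Sum>t\<le>T. real (t + 1)"
  have W: "?W = real (T + 1) * real (T + 2) / 2"
    by (induction T) (auto simp: field_simps)
  have pos: "?W > 0" unfolding W by simp
  have "(\<Sum>k<Suc T. fst (bias (x0 - xs) \<omega> k)) + (\<Sum>k<Suc T. fst (var \<omega> k))
    = (\<Sum>t\<le>T. real (t + 1) *\<^sub>R (acsgd_x \<alpha> \<beta> x0 \<omega> t - xs))"
  proof -
    have "fst (bias (x0 - xs) \<omega> k) + fst (var \<omega> k) = real (k + 1) *\<^sub>R (acsgd_x \<alpha> \<beta> x0 \<omega> k - xs)" for k
      using arg_cong[OF trajectory_decompose[of "x0 - xs" \<omega> k], of fst] acsgd_eq_trajectory[of x0 \<omega> k]
      by (simp add: acsgd_x_def)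
    then show ?thesis
      by (simp only: lessThan_Suc_atMost sum.distrib[symmetric])
  qed
  also have "\<dots> = (\<Sum>t\<le>T. real (t + 1) *\<^sub>R acsgd_x \<alpha> \<beta> x0 \<omega> t) - ?W *\<^sub>R xs"
    by (simp only: scaleR_diff_right sum_subtractf scaleR_sum_left)
  also have "\<dots> = ?W *\<^sub>R (acsgd_avg \<alpha> \<beta> x0 \<omega> T - xs)"
    using pos by (simp add: acsgd_avg_def scaleR_diff_right)
  finally have "(1 / ?W) *\<^sub>R ((\<Sum>k<Suc T. fst (bias (x0 - xs) \<omega> k)) + (\<Sum>k<Suc T. fst (var \<omega> k)))
    = acsgd_avg \<alpha> \<beta> x0 \<omega> T - xs"
    using pos by simp
  then show ?thesis unfolding W by simp
qed

lemma expected_risk_le: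
  assumes T: "1 \<le> T"
  shows "(\<integral>\<^sup>+ \<omega>. ennreal (risk rho (acsgd_avg \<alpha> \<beta> x0 \<omega> T)) \<partial>samples rho)
    \<le> ennreal (risk rho xs + min (12 / (\<alpha> * real T ^ 2)) (48 / (\<beta> * real T)) * (norm (x0 - xs))^2
               + 72 * \<sigma>^2 * real CARD('d) / real T)"
proof -
  let ?n = "real (T + 1)" and ?m = "real (T + 2)"
  let ?w = "2 / (?n * ?m)"
  let ?b = "\<lambda>\<omega> k. fst (bias (x0 - xs) \<omega> k)"
  let ?B = "\<lambda>\<omega>. \<Sum>k<Suc T. ?b \<omega> k" and ?V = "\<lambda>\<omega>. \<Sum>k<Suc T. fst (var \<omega> k)"
  let ?S = "\<lambda>\<omega>. \<Sum>k<Suc T. ?b \<omega> k \<bullet> (H *v ?b \<omega> k)"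
  let ?Q = "\<lambda>\<omega>. ?V \<omega> \<bullet> (H *v ?V \<omega>)"
  \<comment> \<open>Both collect 1/2 from the excess risk, the squared normalisation
    \<open>?w\<close> of the average, and a Young factor, 3/2 for the bias and 3 for the variance;
    \<open>cS\<close> also has \<open>?n\<close> from Jensen's inequality.\<close>
  define cS where "cS = 3/4 * ?w\<^sup>2 * ?n"
  define cV where "cV = 3/2 * ?w\<^sup>2"
  define bS where "bS = min (18/5 * ?n / \<alpha>) (2 * ?n\<^sup>2 / \<beta>) * (norm (x0 - xs))\<^sup>2"
  define bV where "bV = 11/5 * \<sigma>\<^sup>2 * (?n * ?m * real (2 * T + 3)) * real CARD('d)"
  have c_nonneg: "0 \<le> cS" "0 \<le> cV" by (simp_all add: cS_def cV_def)
  have b_nonneg: "0 \<le> bS" "0 \<le> bV"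
    using \<alpha>_pos \<beta>_pos by (simp_all add: bS_def bV_def)
  have S: "0 \<le> ?S \<omega>" and Q: "0 \<le> ?Q \<omega>" for \<omega>
    by (intro sum_nonneg H_nonneg, rule H_nonneg)
  have mS: "?S \<in> borel_measurable (samples rho)"
    by (intro borel_measurable_sum measurable_form measurable_fst_borel measurable_trajectory) simp
  have mQ: "?Q \<in> borel_measurable (samples rho)"
    by (intro measurable_form borel_measurable_sum measurable_fst_borel measurable_var)
  have risk_nonneg: "0 \<le> risk rho xs" by (simp add: risk_def)
  have "risk rho (acsgd_avg \<alpha> \<beta> x0 \<omega> T) \<le> risk rho xs + (cS * ?S \<omega> + cV * ?Q \<omega>)" for \<omega>
  proof -
    \<comment> \<open>The weight 1/2 favours the bias: it leads to 54/5 \<le> 12 in the first bound,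
      where weight 1 would give 72/5. The variance term has room for the factor 3.\<close>
    have "(?B \<omega> + ?V \<omega>) \<bullet> (H *v (?B \<omega> + ?V \<omega>)) \<le> 3/2 * (?B \<omega> \<bullet> (H *v ?B \<omega>)) + 3 * ?Q \<omega>"
      using h_form_young[of "1/2" "?B \<omega>" "?V \<omega>"] by simp
    also have "?B \<omega> \<bullet> (H *v ?B \<omega>) \<le> ?n * ?S \<omega>"
      using h_form_sum_le[of "?b \<omega>" "Suc T"] by simp
    finally have *: "(?B \<omega> + ?V \<omega>) \<bullet> (H *v (?B \<omega> + ?V \<omega>)) \<le> 3/2 * (?n * ?S \<omega>) + 3 * ?Q \<omega>"
      by simp
    have "risk rho (acsgd_avg \<alpha> \<beta> x0 \<omega> T)
      = risk rho xs + 1/2 * (?w\<^sup>2 * ((?B \<omega> + ?V \<omega>) \<bullet> (H *v (?B \<omega> + ?V \<omega>))))"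
      unfolding risk_excess[of "acsgd_avg \<alpha> \<beta> x0 \<omega> T"] acsgd_avg_eq linear_scale[OF linear_h]
      by (simp only: inner_scaleR_left inner_scaleR_right power2_eq_square mult.assoc)
    also have "\<dots> \<le> risk rho xs + 1/2 * (?w\<^sup>2 * (3/2 * (?n * ?S \<omega>) + 3 * ?Q \<omega>))"
      by (intro add_left_mono mult_left_mono *) auto
    also have "\<dots> = risk rho xs + (cS * ?S \<omega> + cV * ?Q \<omega>)"
      by (simp only: cS_def cV_def) algebra
    finally show ?thesis .
  qed
  then have "(\<integral>\<^sup>+ \<omega>. ennreal (risk rho (acsgd_avg \<alpha> \<beta> x0 \<omega> T)) \<partial>samples rho)
    \<le> (\<integral>\<^sup>+ \<omega>. ennreal (risk rho xs + (cS * ?S \<omega> + cV * ?Q \<omega>)) \<partial>samples rho)"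
    by (intro nn_integral_mono ennreal_leI)
  also have "\<dots> = (\<integral>\<^sup>+ \<omega>. ennreal (risk rho xs) + (ennreal cS * ennreal (?S \<omega>) + ennreal cV * ennreal (?Q \<omega>)) \<partial>samples rho)"
  proof (rule nn_integral_cong)
    fix \<omega>
    show "ennreal (risk rho xs + (cS * ?S \<omega> + cV * ?Q \<omega>))
      = ennreal (risk rho xs) + (ennreal cS * ennreal (?S \<omega>) + ennreal cV * ennreal (?Q \<omega>))"
      using risk_nonneg c_nonneg S[of \<omega>] Q[of \<omega>]
      by (simp only: ennreal_plus ennreal_mult mult_nonneg_nonneg add_nonneg_nonneg)
  qed
  also have "\<dots> = ennreal (risk rho xs)
     + (ennreal cS * (\<integral>\<^sup>+ \<omega>. ennreal (?S \<omega>) \<partial>samples rho) + ennreal cV * (\<integral>\<^sup>+ \<omega>. ennreal (?Q \<omega>) \<partial>samples rho))"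
    by (intro nn_integral_affine prob_space_stream measurable_compose[OF _ measurable_ennreal] mS mQ)
  also have "\<dots> \<le> ennreal (risk rho xs) + (ennreal cS * ennreal bS + ennreal cV * ennreal bV)"
  proof (intro add_left_mono add_mono mult_left_mono)
    show "(\<integral>\<^sup>+ \<omega>. ennreal (?S \<omega>) \<partial>samples rho) \<le> ennreal bS"
      using bias_total_le[where n = "Suc T" and x = "x0 - xs"] unfolding bS_def by simp
    show "(\<integral>\<^sup>+ \<omega>. ennreal (?Q \<omega>) \<partial>samples rho) \<le> ennreal bV"
      using var_total_le[of "Suc T"] unfolding bV_def by (simp add: numeral_3_eq_3)
  qed auto
  also have "\<dots> = ennreal (risk rho xs + (cS * bS + cV * bV))"
    using risk_nonneg c_nonneg b_nonneg by (simp add: ennreal_mult)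
  also have "\<dots> \<le> ennreal (risk rho xs + min (12 / (\<alpha> * real T ^ 2)) (48 / (\<beta> * real T)) * (norm (x0 - xs))^2
               + 72 * \<sigma>^2 * real CARD('d) / real T)"
  proof (rule ennreal_leI)
    have T0: "0 < real T" using T by simp
    have "cS * min (18/5 * ?n / \<alpha>) (2 * ?n\<^sup>2 / \<beta>) \<le> min (12 / (\<alpha> * real T ^ 2)) (48 / (\<beta> * real T))"
    proof (rule min.boundedI)
      have "cS * min (18/5 * ?n / \<alpha>) (2 * ?n\<^sup>2 / \<beta>) \<le> cS * (18/5 * ?n / \<alpha>)"
        by (intro mult_left_mono c_nonneg) simp
      also have "\<dots> = 54/5 / (\<alpha> * ?m\<^sup>2)"
      proof -
        have "3/4 * (2 / (n * m))\<^sup>2 * n * (18/5 * n / \<alpha>) = 54/5 / (\<alpha> * m\<^sup>2)" if "0 < n" "0 < m" for n m :: real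
          using that \<alpha>_pos by (simp add: power2_eq_square field_simps)
        from this[of ?n ?m] show ?thesis by (simp only: cS_def of_nat_0_less_iff add_gr_0) simp
      qed
      also have "\<dots> \<le> 12 / (\<alpha> * real T ^ 2)"
        using \<alpha>_pos T0 by (intro frac_le mult_left_mono power_mono mult_pos_pos) auto
      finally show "cS * min (18/5 * ?n / \<alpha>) (2 * ?n\<^sup>2 / \<beta>) \<le> 12 / (\<alpha> * real T ^ 2)" .
      have "cS * min (18/5 * ?n / \<alpha>) (2 * ?n\<^sup>2 / \<beta>) \<le> cS * (2 * ?n\<^sup>2 / \<beta>)"
        by (intro mult_left_mono c_nonneg) simp
      also have "\<dots> = 6 * ?n / (\<beta> * ?m\<^sup>2)"
      proof -
        have "3/4 * (2 / (n * m))\<^sup>2 * n * (2 * n\<^sup>2 / \<beta>) = 6 * n / (\<beta> * m\<^sup>2)" if "0 < n" "0 < m" for n m :: real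
          using that \<beta>_pos by (simp add: power2_eq_square field_simps)
        from this[of ?n ?m] show ?thesis by (simp only: cS_def of_nat_0_less_iff add_gr_0) simp
      qed
      also have "\<dots> \<le> 48 * ?m / (\<beta> * ?m\<^sup>2)"
        using \<beta>_pos by (intro divide_right_mono) auto
      also have "\<dots> = 48 / (\<beta> * ?m)"
      proof -
        have "48 * m / (\<beta> * m\<^sup>2) = 48 / (\<beta> * m)" for m :: real
          by (simp add: power2_eq_square)
        then show ?thesis .
      qed
      also have "\<dots> \<le> 48 / (\<beta> * real T)"
        using \<beta>_pos T0 by (intro frac_le mult_left_mono mult_pos_pos) auto
      finally show "cS * min (18/5 * ?n / \<alpha>) (2 * ?n\<^sup>2 / \<beta>) \<le> 48 / (\<beta> * real T)" .
    qed
    then have "cS * bS \<le> min (12 / (\<alpha> * real T ^ 2)) (48 / (\<beta> * real T)) * (norm (x0 - xs))^2"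
      unfolding bS_def mult.assoc[symmetric] by (rule mult_right_mono) simp
    moreover have "cV * bV \<le> 72 * \<sigma>^2 * real CARD('d) / real T"
    proof -
      have "cV * bV = \<sigma>\<^sup>2 * real CARD('d) * (66/5 * real (2 * T + 3) / (?n * ?m))"
      proof -
        have *: "3/2 * (2 / (n * m))\<^sup>2 * (11/5 * \<sigma>\<^sup>2 * (n * m * l) * d) = \<sigma>\<^sup>2 * d * (66/5 * l / (n * m))"
          if "0 < n" "0 < m" for n m l d :: real
          using that by (simp add: power2_eq_square field_simps)
        show ?thesis unfolding cV_def bV_def by (rule *) simp_all
      qed
      also have "\<dots> \<le> \<sigma>\<^sup>2 * real CARD('d) * (72 / real T)"
      proof (intro mult_left_mono)
        have cross: "a / c \<le> b / d" if "a * d \<le> b * c" "0 < c" "0 < d" for a b c d :: real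
          using that by (simp add: field_simps)
        have "0 \<le> real T * real T" by simp
        then have "66/5 * real (2 * T + 3) * real T \<le> 72 * (?n * ?m)"
          by (simp add: algebra_simps)
        then show "66/5 * real (2 * T + 3) / (?n * ?m) \<le> 72 / real T"
          by (rule cross) (use T0 in simp_all)
      qed simp
      finally show ?thesis by (simp add: mult_ac)
    qed
    ultimately show "risk rho xs + (cS * bS + cV * bV)
      \<le> risk rho xs + min (12 / (\<alpha> * real T ^ 2)) (48 / (\<beta> * real T)) * (norm (x0 - xs))^2
               + 72 * \<sigma>^2 * real CARD('d) / real T"
      by linarith
  qed
  finally show ?thesis .
qed

end

text \<open>The expectation is a nonnegative integral of the nonnegative risk, so that the bound
  includes its finiteness.\<close>

theorem theorem1:
  fixes rho :: "('d::finite sample) measure"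
    and xs x0 :: "real ^ 'd"
    and R \<sigma> \<kappa> \<alpha> \<beta> :: real
    and T :: nat
  defines "H \<equiv> wsecond rho (\<lambda>p. 1)"
  assumes prob: "prob_space rho"
    and sets_rho: "sets rho = sets borel"
    and int_a: "integrable rho (\<lambda>p. (norm (fst p))^2)"
    and int_b: "integrable rho (\<lambda>p. (snd p)^2)"
    and H_inv: "invertible H"
    and xs_min: "\<forall>x. risk rho xs \<le> risk rho x"
    and int_i: "\<forall>i j. integrable rho (\<lambda>p. (norm (fst p))^2 * (fst p $ i) * (fst p $ j))"
    and int_ii: "\<forall>i j. integrable rho (\<lambda>p. (snd p - xs \<bullet> fst p)^2 * (fst p $ i) * (fst p $ j))"
    and int_iii: "\<forall>i j. integrable rho
                    (\<lambda>p. (fst p \<bullet> (matrix_inv H *v fst p)) * (fst p $ i) * (fst p $ j))"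
    and cond_i: "loewner_le (wsecond rho (\<lambda>p. (norm (fst p))^2)) (R^2 *\<^sub>R H)"
    and cond_ii: "loewner_le (wsecond rho (\<lambda>p. (snd p - xs \<bullet> fst p)^2)) (\<sigma>^2 *\<^sub>R H)"
    and cond_iii: "loewner_le (wsecond rho (\<lambda>p. fst p \<bullet> (matrix_inv H *v fst p))) (\<kappa> *\<^sub>R H)"
    and \<alpha>_pos: "\<alpha> > 0" and \<beta>_pos: "\<beta> > 0"
    and step1: "(\<alpha> + 2 * \<beta>) * R^2 \<le> 1"
    and step2: "\<alpha> \<le> \<beta> / (2 * \<kappa>)"
    and T_pos: "T \<ge> 1"
  shows "(\<integral>\<^sup>+ \<omega>. ennreal (risk rho (acsgd_avg \<alpha> \<beta> x0 \<omega> T)) \<partial>(PiM UNIV (\<lambda>_::nat. rho)))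
          \<le> ennreal (risk rho xs
               + min (12 / (\<alpha> * real T ^ 2)) (48 / (\<beta> * real T)) * (norm (x0 - xs))^2
               + 72 * \<sigma>^2 * real CARD('d) / real T)"
proof -
  interpret least_squares rho xs R \<sigma> \<kappa> \<alpha> \<beta> H
    unfolding least_squares_def least_squares_axioms_def H_def[symmetric]
    using assms(2-) by (auto simp: H_def)
  show ?thesis using T_pos by (rule expected_risk_le)
qed

end
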